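(* Let $T>0$ and let $(\mathbf{M}^n,g(t))$, $t\in[0,T]$, be a smooth solution to the Ricci flow $\partial_t g=-2\,\mathrm{Ric}$ on an $n$-dimensional closed Riemannian manifold. Then for every $t\in(0,T)$ the scalar curvature $R$ satisfies $$\inf_{x\in\mathbf{M}}R(x,t)\le\frac{2n}{t}+\frac{2n}{T-t}.$$
   Context: $R(x,t)$ denotes the scalar curvature of the metric $g(t)$ at the point $x$. *)

theory Defs
  imports "HOL-Analysis.Analysis"
begin

section \<open>Smooth functions\<close>

text \<open>
  Derivatives are taken within S.  The definition is used for open S and for
  S = V \<times> [0,T] with V open and T > 0; on such sets the derivative
  within S is unique, and on the latter smoothness means smoothness up to the boundary
  (one-sided time derivatives at 0 and T).
\<close>

primrec Ck_on :: "nat \<Rightarrow> ('a::real_normed_vector \<Rightarrow> 'b::real_normed_vector) \<Rightarrow> 'a set \<Rightarrow> bool" where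
  "Ck_on 0 f S \<longleftrightarrow> continuous_on S f"
| "Ck_on (Suc k) f S \<longleftrightarrow>
     (\<exists>f'. (\<forall>x\<in>S. (f has_derivative f' x) (at x within S)) \<and>
           (\<forall>v. Ck_on k (\<lambda>x. f' x v) S))"

definition smooth_on :: "('a::real_normed_vector \<Rightarrow> 'b::real_normed_vector) \<Rightarrow> 'a set \<Rightarrow> bool" where
  "smooth_on f S \<longleftrightarrow> (\<forall>k. Ck_on k f S)"

section \<open>Closed smooth manifolds\<close>

text \<open>
  A chart is a pair of a domain and a coordinate map; values of the coordinate map outside
  the domain are irrelevant.  An atlas need not be maximal.
\<close>

type_synonym ('m, 'n) chart = "'m set \<times> ('m \<Rightarrow> real^'n)"

definition chart_on :: "'m topology \<Rightarrow> ('m, 'n::finite) chart \<Rightarrow> bool" where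
  "chart_on M c \<longleftrightarrow>
     openin M (fst c) \<and> open (snd c ` fst c) \<and>
     homeomorphic_map (subtopology M (fst c)) (top_of_set (snd c ` fst c)) (snd c)"

definition chart_inv :: "('m, 'n::finite) chart \<Rightarrow> real^'n \<Rightarrow> 'm" where
  "chart_inv c = inv_into (fst c) (snd c)"

definition transition :: "('m, 'n::finite) chart \<Rightarrow> ('m, 'n) chart \<Rightarrow> real^'n \<Rightarrow> real^'n" where
  "transition c d = snd d \<circ> chart_inv c"

definition smooth_atlas :: "'m topology \<Rightarrow> ('m, 'n::finite) chart set \<Rightarrow> bool" where
  "smooth_atlas M A \<longleftrightarrow>
     (\<forall>c\<in>A. chart_on M c) \<and>
     (\<Union>c\<in>A. fst c) = topspace M \<and>
     (\<forall>c\<in>A. \<forall>d\<in>A. smooth_on (transition c d) (snd c ` (fst c \<inter> fst d)))"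

text \<open>
  A closed (compact, without boundary) smooth manifold of dimension n = CARD('n).
  Connectedness is not required.
\<close>

definition closed_manifold :: "'m topology \<Rightarrow> ('m, 'n::finite) chart set \<Rightarrow> bool" where
  "closed_manifold M A \<longleftrightarrow>
     topspace M \<noteq> {} \<and> Hausdorff_space M \<and> second_countable M \<and> compact_space M \<and>
     smooth_atlas M A"

section \<open>Tangent spaces and Riemannian metrics\<close>

text \<open>
  A tangent vector at p assigns to every chart around p a coordinate vector, such that the
  coordinate vectors transform by the Jacobians of the transition maps.  The value is 0 at
  all other charts, so that tangent vectors are determined by their meaningful values.
\<close>

type_synonym ('m, 'n) tangent = "('m, 'n) chart \<Rightarrow> real^'n"

definition tangent_space :: "('m, 'n::finite) chart set \<Rightarrow> 'm \<Rightarrow> ('m, 'n) tangent set" where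
  "tangent_space A p =
     {X. (\<forall>c. \<not> (c \<in> A \<and> p \<in> fst c) \<longrightarrow> X c = 0) \<and>
         (\<forall>c\<in>A. \<forall>d\<in>A. p \<in> fst c \<inter> fst d \<longrightarrow>
            X d = frechet_derivative (transition c d) (at (snd c p)) (X c))}"

text \<open>The coordinate vector field of index i of the chart c, at p.\<close>

definition coord_vector ::
    "('m, 'n::finite) chart set \<Rightarrow> ('m, 'n) chart \<Rightarrow> 'n \<Rightarrow> 'm \<Rightarrow> ('m, 'n) tangent" where
  "coord_vector A c i p =
     (\<lambda>d. if d \<in> A \<and> p \<in> fst d
          then frechet_derivative (transition c d) (at (snd c p)) (axis i 1) else 0)"

type_synonym ('m, 'n) metric = "'m \<Rightarrow> ('m, 'n) tangent \<Rightarrow> ('m, 'n) tangent \<Rightarrow> real"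

definition inner_product_on_tangent ::
    "('m, 'n::finite) chart set \<Rightarrow> 'm \<Rightarrow> (('m, 'n) tangent \<Rightarrow> ('m, 'n) tangent \<Rightarrow> real) \<Rightarrow> bool" where
  "inner_product_on_tangent A p B \<longleftrightarrow>
     (\<forall>X\<in>tangent_space A p. \<forall>Y\<in>tangent_space A p. B X Y = B Y X) \<and>
     (\<forall>X\<in>tangent_space A p. \<forall>Y\<in>tangent_space A p. \<forall>Z\<in>tangent_space A p. \<forall>a.
        B (\<lambda>c. a *\<^sub>R X c + Y c) Z = a * B X Z + B Y Z) \<and>
     (\<forall>X\<in>tangent_space A p. X \<noteq> (\<lambda>c. 0) \<longrightarrow> B X X > 0)"

text \<open>The matrix of the metric h in the chart c, as a function of the coordinates.\<close>

definition metric_matrix ::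
    "('m, 'n::finite) chart set \<Rightarrow> ('m, 'n) metric \<Rightarrow> ('m, 'n) chart \<Rightarrow> real^'n \<Rightarrow> real^'n^'n" where
  "metric_matrix A h c x =
     (\<chi> i j. h (chart_inv c x)
               (coord_vector A c i (chart_inv c x)) (coord_vector A c j (chart_inv c x)))"

definition riemannian_metric ::
    "'m topology \<Rightarrow> ('m, 'n::finite) chart set \<Rightarrow> ('m, 'n) metric \<Rightarrow> bool" where
  "riemannian_metric M A h \<longleftrightarrow>
     (\<forall>p\<in>topspace M. inner_product_on_tangent A p (h p)) \<and>
     (\<forall>c\<in>A. smooth_on (metric_matrix A h c) (snd c ` fst c))"

section \<open>Curvature in local coordinates\<close>

text \<open>Here G is the matrix of a metric in local coordinates.\<close>

definition partial :: "'n::finite \<Rightarrow> (real^'n \<Rightarrow> real) \<Rightarrow> real^'n \<Rightarrow> real" where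
  "partial k f x = frechet_derivative f (at x) (axis k 1)"

definition christoffel ::
    "(real^'n \<Rightarrow> real^'n^'n) \<Rightarrow> 'n::finite \<Rightarrow> 'n \<Rightarrow> 'n \<Rightarrow> real^'n \<Rightarrow> real" where
  "christoffel G k i j x =
     (1/2) * (\<Sum>l\<in>UNIV. matrix_inv (G x) $ k $ l *
       (partial i (\<lambda>y. G y $ j $ l) x + partial j (\<lambda>y. G y $ i $ l) x
         - partial l (\<lambda>y. G y $ i $ j) x))"

text \<open>
  Component l of R(e_i, e_j) e_k, where e_i are the coordinate vector fields and
  R(X,Y)Z = D_X D_Y Z - D_Y D_X Z - D_[X,Y] Z for the Levi-Civita connection D.
\<close>

definition riemann ::
    "(real^'n \<Rightarrow> real^'n^'n) \<Rightarrow> 'n::finite \<Rightarrow> 'n \<Rightarrow> 'n \<Rightarrow> 'n \<Rightarrow> real^'n \<Rightarrow> real" where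
  "riemann G l i j k x =
     partial i (christoffel G l j k) x - partial j (christoffel G l i k) x
     + (\<Sum>m\<in>UNIV. christoffel G m j k x * christoffel G l i m x
                   - christoffel G m i k x * christoffel G l j m x)"

text \<open>
  Ric(Y,Z) is the trace of X \<mapsto> R(X,Y)Z.  With this sign convention round spheres
  have positive Ricci and scalar curvature.
\<close>

definition ricci :: "(real^'n \<Rightarrow> real^'n^'n) \<Rightarrow> 'n::finite \<Rightarrow> 'n \<Rightarrow> real^'n \<Rightarrow> real" where
  "ricci G j k x = (\<Sum>i\<in>UNIV. riemann G i i j k x)"

definition scalar_curvature_coord :: "(real^'n \<Rightarrow> real^'n^'n) \<Rightarrow> real^'n::finite \<Rightarrow> real" where
  "scalar_curvature_coord G x =
     (\<Sum>j\<in>UNIV. \<Sum>k\<in>UNIV. matrix_inv (G x) $ j $ k * ricci G j k x)"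

section \<open>Scalar curvature and Ricci flow on a manifold\<close>

text \<open>
  The scalar curvature of a Riemannian metric at p does not depend on the chart around p,
  so an arbitrary one is chosen.
\<close>

definition scalar_curvature ::
    "('m, 'n::finite) chart set \<Rightarrow> ('m, 'n) metric \<Rightarrow> 'm \<Rightarrow> real" where
  "scalar_curvature A h p =
     (let c = (SOME c. c \<in> A \<and> p \<in> fst c)
      in scalar_curvature_coord (metric_matrix A h c) (snd c p))"

text \<open>
  A smooth solution, jointly in space and time on M \<times> [0,T], of the Ricci flow equation,
  an equation between tensors and hence written in components in every chart of the atlas.
  At t = 0 and t = T the time derivative is one-sided.
\<close>

definition ricci_flow ::
    "'m topology \<Rightarrow> ('m, 'n::finite) chart set \<Rightarrow> real \<Rightarrow> (real \<Rightarrow> ('m, 'n) metric) \<Rightarrow> bool" where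
  "ricci_flow M A T g \<longleftrightarrow>
     (\<forall>t\<in>{0..T}. riemannian_metric M A (g t)) \<and>
     (\<forall>c\<in>A. smooth_on (\<lambda>(x, t). metric_matrix A (g t) c x) ((snd c ` fst c) \<times> {0..T})) \<and>
     (\<forall>c\<in>A. \<forall>x\<in>snd c ` fst c. \<forall>t\<in>{0..T}. \<forall>i j.
        ((\<lambda>s. metric_matrix A (g s) c x $ i $ j) has_real_derivative
           - 2 * ricci (metric_matrix A (g t) c) i j x) (at t within {0..T}))"

end

(*
  Along the Ricci flow dR/dt = Delta R + 2 |Ric|^2 >= Delta R + (2/n) R^2.  At the first time at which
  (t1 - t) min R falls to n, with t1 = (t0 + T)/2, a spatial minimum has Delta R >= 0 and
  R = n / (t1 - t) > 0, so that (t1 - t) R - n has time derivative at least R > 0, which is absurd;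
  hence min R(., t0) <= n / (t1 - t0) = 2n / (T - t0).

  The evolution equation is obtained in a fixed chart.  With G the matrix of the metric, H its inverse,
  Gam the Christoffel symbols and a dot for d/dt, tracing the variation of the Ricci tensor gives a
  divergence of V^i = H^jk (Gam^i_jk)' - H^ik (Gam^m_mk)'.  The first term vanishes by the contracted
  Bianchi identity, and the second one is the gradient of R because Gam^m_mk = d_k log(det G) / 2 and
  R = - tr (H G') / 2.  The last formula also shows that R does not depend on the chart, without any
  transformation rule for Christoffel symbols: G' inherits the tensorial behaviour of G.
*)

theory Submission
  imports Defs
begin

subsection \<open>Smooth functions on open sets\<close>

text \<open>The comparison function n / (t1 - t) solves y' = y^2 / n, while R grows at a spatial
  minimum at rate at least (2/n) R^2. This spare factor 2 makes the contact at the first time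
  strict, so the comparison function need not be perturbed. The calculus lives on open sets, hence
  on times 0 < t < T, and the comparison is run up to some t1 < T; the midpoint turns n / (t1 - t0)
  into 2n / (T - t0).

  Space and time form one normed space in which coordinate directions and the time direction are
  just vectors. Time and space derivatives then commute by one and the same Schwarz theorem. There
  are no covariant derivatives: tensors are arrays of functions, each covariant identity appears
  with its Christoffel terms written out, and the basic curvature identities are identities between
  connection matrices.

  No orthonormal frames are introduced either. Both sign facts, |Ric|^2 >= R^2 / n and Delta R >= 0
  at a minimum, rest on one lemma: a positive definite matrix pairs nonnegatively with a positive
  semidefinite one.\<close>

lemma Ck_on_Suc_D: "Ck_on (Suc k) f S \<Longrightarrow> Ck_on k f S"
proof (induction k arbitrary: f)
  case 0
  then show ?case by (auto simp: continuous_on_eq_continuous_within intro: has_derivative_continuous)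
next
  case (Suc k)
  then obtain f' where "\<forall>x\<in>S. (f has_derivative f' x) (at x within S)"
    and "\<forall>v. Ck_on (Suc k) (\<lambda>x. f' x v) S"
    using Ck_on.simps(2)[of "Suc k" f S] by blast
  then show ?case unfolding Ck_on.simps(2)[of k f S] using Suc.IH by blast
qed

lemma Ck_on_subset: "Ck_on k f S \<Longrightarrow> U \<subseteq> S \<Longrightarrow> Ck_on k f U"
proof (induction k arbitrary: f)
  case 0
  then show ?case by (auto intro: continuous_on_subset)
next
  case (Suc k)
  then obtain f' where "\<forall>x\<in>S. (f has_derivative f' x) (at x within S)"
    and "\<forall>v. Ck_on k (\<lambda>x. f' x v) S"
    by auto
  then have "\<forall>x\<in>U. (f has_derivative f' x) (at x within U)" "\<forall>v. Ck_on k (\<lambda>x. f' x v) U"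
    using Suc has_derivative_subset by blast+
  then show ?case by auto
qed

lemma Ck_on_cong: "Ck_on k f S \<Longrightarrow> (\<And>x. x \<in> S \<Longrightarrow> f x = g x) \<Longrightarrow> Ck_on k g S"
proof (induction k arbitrary: f g)
  case 0
  then show ?case by (simp cong: continuous_on_cong)
next
  case (Suc k)
  then obtain f' where f': "\<forall>x\<in>S. (f has_derivative f' x) (at x within S)"
    and "\<forall>v. Ck_on k (\<lambda>x. f' x v) S"
    by auto
  moreover have "\<forall>x\<in>S. (g has_derivative f' x) (at x within S)"
    using f' Suc.prems(2) by (metis has_derivative_transform)
  ultimately show ?case by auto
qed

lemma Ck_on_const: "Ck_on k (\<lambda>x. c) S"
proof (induction k arbitrary: c)
  case (Suc k)
  then show ?case by (auto intro!: exI[of _ "\<lambda>x v. 0"])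
qed auto

lemma Ck_on_linear:
  assumes "bounded_linear L"
  shows "Ck_on k f S \<Longrightarrow> Ck_on k (\<lambda>x. L (f x)) S"
proof (induction k arbitrary: f)
  case 0
  then show ?case by (simp add: bounded_linear.continuous_on[OF assms])
next
  case (Suc k)
  then obtain f' where "\<forall>x\<in>S. (f has_derivative f' x) (at x within S)"
    and "\<forall>v. Ck_on k (\<lambda>x. f' x v) S"
    by auto
  then show ?case
    using Suc.IH
    by (auto intro!: exI[of _ "\<lambda>x v. L (f' x v)"] bounded_linear.has_derivative[OF assms])
qed

lemma Ck_on_add:
  "Ck_on k f S \<Longrightarrow> Ck_on k g S \<Longrightarrow> Ck_on k (\<lambda>x. f x + g x) S"
proof (induction k arbitrary: f g)
  case 0
  then show ?case by (auto intro: continuous_intros)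
next
  case (Suc k)
  then obtain f' g' where "\<forall>x\<in>S. (f has_derivative f' x) (at x within S)"
    and "\<forall>v. Ck_on k (\<lambda>x. f' x v) S"
    and "\<forall>x\<in>S. (g has_derivative g' x) (at x within S)"
    and "\<forall>v. Ck_on k (\<lambda>x. g' x v) S"
    by auto
  then show ?case
    using Suc.IH has_derivative_add by (auto intro!: exI[of _ "\<lambda>x v. f' x v + g' x v"])
qed

lemma Ck_on_mult:
  fixes f g :: "'a::real_normed_vector \<Rightarrow> real"
  shows "Ck_on k f S \<Longrightarrow> Ck_on k g S \<Longrightarrow> Ck_on k (\<lambda>x. f x * g x) S"
proof (induction k arbitrary: f g)
  case 0
  then show ?case by (auto intro: continuous_intros)
next
  case (Suc k)
  then obtain f' g' where fg: "\<forall>x\<in>S. (f has_derivative f' x) (at x within S)"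
    "\<forall>v. Ck_on k (\<lambda>x. f' x v) S"
    "\<forall>x\<in>S. (g has_derivative g' x) (at x within S)"
    "\<forall>v. Ck_on k (\<lambda>x. g' x v) S"
    by auto
  have "Ck_on k f S" "Ck_on k g S"
    using Suc.prems Ck_on_Suc_D by blast+
  then have "\<forall>v. Ck_on k (\<lambda>x. f x * g' x v + f' x v * g x) S"
    using fg by (intro allI Ck_on_add Suc.IH) auto
  moreover have "\<forall>x\<in>S. ((\<lambda>x. f x * g x) has_derivative (\<lambda>v. f x * g' x v + f' x v * g x)) (at x within S)"
    using fg has_derivative_mult by blast
  ultimately show ?case by (auto intro!: exI[of _ "\<lambda>x v. f x * g' x v + f' x v * g x"])
qed

lemma Ck_on_inverse:
  fixes f :: "'a::real_normed_vector \<Rightarrow> real"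
  assumes "\<And>x. x \<in> S \<Longrightarrow> f x \<noteq> 0"
  shows "Ck_on k f S \<Longrightarrow> Ck_on k (\<lambda>x. inverse (f x)) S"
proof (induction k)
  case 0
  then show ?case using assms by (auto intro: continuous_intros)
next
  case (Suc k)
  then obtain f' where f: "\<forall>x\<in>S. (f has_derivative f' x) (at x within S)"
    "\<forall>v. Ck_on k (\<lambda>x. f' x v) S"
    by auto
  have *: "Ck_on k (\<lambda>x. inverse (f x)) S"
    using Suc Ck_on_Suc_D by blast
  have "\<forall>v. Ck_on k (\<lambda>x. - (inverse (f x) * f' x v * inverse (f x))) S"
    using * f by (intro allI Ck_on_linear[OF bounded_linear_minus[OF bounded_linear_ident]] Ck_on_mult) auto
  moreover have "\<forall>x\<in>S. ((\<lambda>x. inverse (f x)) has_derivative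
      (\<lambda>v. - (inverse (f x) * f' x v * inverse (f x)))) (at x within S)"
    using f assms by (auto intro!: has_derivative_inverse)
  ultimately show ?case
    by (auto intro!: exI[of _ "\<lambda>x v. - (inverse (f x) * f' x v * inverse (f x))"])
qed

lemma smooth_on_subset: "smooth_on f S \<Longrightarrow> U \<subseteq> S \<Longrightarrow> smooth_on f U"
  unfolding smooth_on_def using Ck_on_subset by blast

lemma smooth_on_cong: "smooth_on f S \<Longrightarrow> (\<And>x. x \<in> S \<Longrightarrow> f x = h x) \<Longrightarrow> smooth_on h S"
  unfolding smooth_on_def using Ck_on_cong by blast

lemma smooth_on_linear: "bounded_linear L \<Longrightarrow> smooth_on f S \<Longrightarrow> smooth_on (\<lambda>x. L (f x)) S"
  by (simp add: smooth_on_def Ck_on_linear)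

lemma smooth_on_imp_continuous_on: "smooth_on f S \<Longrightarrow> continuous_on S f"
  unfolding smooth_on_def by (metis Ck_on.simps(1))

named_theorems smooth_intros

lemma smooth_on_const [smooth_intros]: "smooth_on (\<lambda>x. c) S"
  by (simp add: smooth_on_def Ck_on_const)

lemma smooth_on_add [smooth_intros]:
  "smooth_on f S \<Longrightarrow> smooth_on h S \<Longrightarrow> smooth_on (\<lambda>x. f x + h x) S"
  by (simp add: smooth_on_def Ck_on_add)

lemma smooth_on_minus [smooth_intros]: "smooth_on f S \<Longrightarrow> smooth_on (\<lambda>x. - f x) S"
  by (rule smooth_on_linear[OF bounded_linear_minus[OF bounded_linear_ident]])

lemma smooth_on_diff [smooth_intros]:
  "smooth_on f S \<Longrightarrow> smooth_on h S \<Longrightarrow> smooth_on (\<lambda>x. f x - h x) S"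
  using smooth_on_add[of f S "\<lambda>x. - h x"] smooth_on_minus[of h S] by simp

lemma smooth_on_mult [smooth_intros]:
  fixes f h :: "'a::real_normed_vector \<Rightarrow> real"
  shows "smooth_on f S \<Longrightarrow> smooth_on h S \<Longrightarrow> smooth_on (\<lambda>x. f x * h x) S"
  by (simp add: smooth_on_def Ck_on_mult)

lemma smooth_on_inverse:
  fixes f :: "'a::real_normed_vector \<Rightarrow> real"
  shows "smooth_on f S \<Longrightarrow> (\<And>x. x \<in> S \<Longrightarrow> f x \<noteq> 0) \<Longrightarrow> smooth_on (\<lambda>x. inverse (f x)) S"
  by (simp add: smooth_on_def Ck_on_inverse)

lemma smooth_on_sum [smooth_intros]:
  "(\<And>i. i \<in> I \<Longrightarrow> smooth_on (f i) S) \<Longrightarrow> smooth_on (\<lambda>x. \<Sum>i\<in>I. f i x) S"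
  by (induction I rule: infinite_finite_induct) (auto intro: smooth_intros)

lemma smooth_on_prod [smooth_intros]:
  fixes f :: "'i \<Rightarrow> 'a::real_normed_vector \<Rightarrow> real"
  shows "(\<And>i. i \<in> I \<Longrightarrow> smooth_on (f i) S) \<Longrightarrow> smooth_on (\<lambda>x. \<Prod>i\<in>I. f i x) S"
  by (induction I rule: infinite_finite_induct) (auto intro: smooth_intros)

text \<open>The direction comes first and may be any vector, so that on space-time the coordinate
  derivatives and the time derivative are instances of one operator.\<close>

definition dder :: "'a::real_normed_vector \<Rightarrow> ('a \<Rightarrow> 'b::real_normed_vector) \<Rightarrow> 'a \<Rightarrow> 'b" where
  "dder v f x = frechet_derivative f (at x) v"

lemma dder_eq: "(f has_derivative f') (at x) \<Longrightarrow> dder v f x = f' v"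
  by (metis dder_def frechet_derivative_at)

lemma smooth_on_has_derivative:
  assumes "smooth_on f S" "open S" "x \<in> S"
  shows "(f has_derivative (\<lambda>v. dder v f x)) (at x)"
proof -
  have "Ck_on (Suc 0) f S" using assms(1) smooth_on_def by blast
  then obtain f' where "(f has_derivative f') (at x within S)" using assms(3) by auto
  then have "(f has_derivative f') (at x)" by (simp add: assms(2,3) at_within_open_NO_MATCH)
  then show ?thesis by (simp add: dder_eq[of f f' x])
qed

text \<open>\<open>Ck_on\<close> supplies a derivative field separately for each order. On an open
  set derivatives are unique, so all these fields coincide with \<open>dder\<close>, which therefore
  has every order of differentiability at once.\<close>

lemma smooth_on_dder [smooth_intros]:
  assumes "open S" "smooth_on f S"
  shows "smooth_on (dder v f) S"
  unfolding smooth_on_def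
proof
  fix k
  have "Ck_on (Suc k) f S" using assms(2) smooth_on_def by blast
  then obtain f' where f': "\<forall>x\<in>S. (f has_derivative f' x) (at x within S)" "\<forall>v. Ck_on k (\<lambda>x. f' x v) S"
    by auto
  then have "\<And>x. x \<in> S \<Longrightarrow> f' x v = dder v f x"
    using assms(1) by (metis at_within_open dder_eq)
  then show "Ck_on k (dder v f) S" using f'(2) Ck_on_cong by blast
qed

text \<open>The device by which identities are differentiated: an equation valid throughout the open
  set passes to the derivatives, and only one side has to be known smooth.\<close>

lemma dder_cong:
  assumes "open S" "x \<in> S" "smooth_on f S" "\<And>y. y \<in> S \<Longrightarrow> f y = h y"
  shows "dder v f x = dder v h x"
  using has_derivative_transform_within_open[OF smooth_on_has_derivative[OF assms(3,1,2)] assms(1,2,4)]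
  by (metis dder_eq)

lemma dder_const: "dder v (\<lambda>x. c) x = 0"
  using dder_eq[OF has_derivative_const] by fast

locale open_set =
  fixes S :: "'a::real_normed_vector set"
  assumes open_S: "open S"
begin

lemma has_dder: "smooth_on f S \<Longrightarrow> x \<in> S \<Longrightarrow> (f has_derivative (\<lambda>v. dder v f x)) (at x)"
  by (rule smooth_on_has_derivative[OF _ open_S])

lemmas smooth_dder [smooth_intros] = smooth_on_dder[OF open_S]

lemma dder_add: "x \<in> S \<Longrightarrow> smooth_on f S \<Longrightarrow> smooth_on h S \<Longrightarrow>
    dder v (\<lambda>y. f y + h y) x = dder v f x + dder v h x"
  by (rule dder_eq, rule has_derivative_add) (auto intro: has_dder)

lemma dder_diff: "x \<in> S \<Longrightarrow> smooth_on f S \<Longrightarrow> smooth_on h S \<Longrightarrow>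
    dder v (\<lambda>y. f y - h y) x = dder v f x - dder v h x"
  by (rule dder_eq, rule has_derivative_diff) (auto intro: has_dder)

lemma dder_minus: "x \<in> S \<Longrightarrow> smooth_on f S \<Longrightarrow> dder v (\<lambda>y. - f y) x = - dder v f x"
  by (rule dder_eq, rule has_derivative_minus) (auto intro: has_dder)

lemma dder_mult:
  fixes f h :: "'a \<Rightarrow> real"
  shows "x \<in> S \<Longrightarrow> smooth_on f S \<Longrightarrow> smooth_on h S \<Longrightarrow>
    dder v (\<lambda>y. f y * h y) x = f x * dder v h x + dder v f x * h x"
  by (rule dder_eq, rule has_derivative_mult) (auto intro: has_dder)

lemma dder_cmult:
  fixes f :: "'a \<Rightarrow> real"
  shows "x \<in> S \<Longrightarrow> smooth_on f S \<Longrightarrow> dder v (\<lambda>y. c * f y) x = c * dder v f x"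
  using dder_mult[of x "\<lambda>_. c" f v] by (simp add: dder_const smooth_on_const)

lemma dder_sum: "x \<in> S \<Longrightarrow> (\<And>i. i \<in> I \<Longrightarrow> smooth_on (f i) S) \<Longrightarrow>
    dder v (\<lambda>y. \<Sum>i\<in>I. f i y) x = (\<Sum>i\<in>I. dder v (f i) x)"
  by (rule dder_eq, rule has_derivative_sum) (auto intro: has_dder)

lemmas dder_rules = dder_add dder_diff dder_minus dder_cmult dder_mult dder_sum

lemma dder_line:
  assumes "smooth_on f S" "x + s *\<^sub>R v \<in> S"
  shows "((\<lambda>s. f (x + s *\<^sub>R v)) has_vector_derivative dder v f (x + s *\<^sub>R v)) (at s)"
proof -
  have "((\<lambda>s. f (x + s *\<^sub>R v)) has_derivative (\<lambda>t. dder (t *\<^sub>R v) f (x + s *\<^sub>R v))) (at s)"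
    by (rule has_derivative_compose[where f = "\<lambda>s. x + s *\<^sub>R v" and g = f])
      (auto intro!: derivative_eq_intros has_dder[OF assms])
  moreover have "dder (t *\<^sub>R v) f (x + s *\<^sub>R v) = t *\<^sub>R dder v f (x + s *\<^sub>R v)" for t
    using has_dder[OF assms] by (meson has_derivative_bounded_linear linear_simps(5))
  ultimately show ?thesis by (simp add: has_vector_derivative_def)
qed

text \<open>The mean value theorem is applied twice: along v to the increment of f in direction w,
  then along w to the derivative \<open>dder v f\<close>. The left-hand side is symmetric in v and
  w, which is what Schwarz's theorem exploits.\<close>

lemma second_difference_mean_value:
  fixes f :: "'a \<Rightarrow> real"
  assumes f: "smooth_on f S" and s: "s > 0"
    and box: "\<And>a b. 0 \<le> a \<Longrightarrow> a \<le> s \<Longrightarrow> 0 \<le> b \<Longrightarrow> b \<le> s \<Longrightarrow> x + a *\<^sub>R v + b *\<^sub>R w \<in> S"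
  shows "\<exists>a b. 0 < a \<and> a < s \<and> 0 < b \<and> b < s \<and>
    f (x + s *\<^sub>R v + s *\<^sub>R w) - f (x + s *\<^sub>R v) - f (x + s *\<^sub>R w) + f x
      = s * s * dder w (dder v f) (x + a *\<^sub>R v + b *\<^sub>R w)"
proof -
  let ?p = "\<lambda>a. f (x + s *\<^sub>R w + a *\<^sub>R v) - f (x + a *\<^sub>R v)"
  have 1: "(?p has_real_derivative
      dder v f (x + s *\<^sub>R w + a *\<^sub>R v) - dder v f (x + a *\<^sub>R v)) (at a)"
    if "0 \<le> a" "a \<le> s" for a
    using dder_line[OF f, of "x + s *\<^sub>R w" a v] dder_line[OF f, of x a v] box[of a s] box[of a 0] that s
    by (intro DERIV_diff) (auto simp: has_real_derivative_iff_has_vector_derivative algebra_simps)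
  obtain a where a: "0 < a" "a < s"
    "?p s - ?p 0 = (s - 0) * (dder v f (x + s *\<^sub>R w + a *\<^sub>R v) - dder v f (x + a *\<^sub>R v))"
    using MVT2[of 0 s ?p, OF s 1] by auto
  let ?q = "\<lambda>b. dder v f (x + a *\<^sub>R v + b *\<^sub>R w)"
  have 2: "(?q has_real_derivative dder w (dder v f) (x + a *\<^sub>R v + b *\<^sub>R w)) (at b)"
    if "0 \<le> b" "b \<le> s" for b
    using dder_line[OF smooth_dder[OF f], of "x + a *\<^sub>R v" b w] box[of a b] that a
    by (auto simp: has_real_derivative_iff_has_vector_derivative)
  obtain b where b: "0 < b" "b < s" "?q s - ?q 0 = (s - 0) * dder w (dder v f) (x + a *\<^sub>R v + b *\<^sub>R w)"
    using MVT2[of 0 s ?q, OF s 2] by auto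
  show ?thesis
    using a b by (intro exI[of _ a] exI[of _ b]) (auto simp: algebra_simps)
qed

text \<open>Schwarz's theorem. The same second difference equals s^2 times either mixed derivative
  at some point of a small parallelogram. If the two derivatives differed at x, continuity would
  keep them apart on the whole parallelogram.\<close>

lemma dder_commute:
  fixes f :: "'a \<Rightarrow> real"
  assumes f: "smooth_on f S" and x: "x \<in> S"
  shows "dder v (dder w f) x = dder w (dder v f) x"
proof (rule ccontr)
  assume neq: "\<not> ?thesis"
  define e where "e = \<bar>dder v (dder w f) x - dder w (dder v f) x\<bar> / 2"
  have e: "e > 0" using neq by (simp add: e_def)
  have cont: "isCont (dder v (dder w f)) x" "isCont (dder w (dder v f)) x"
    using smooth_on_imp_continuous_on[OF smooth_dder[OF smooth_dder[OF f]]] open_S x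
    by (auto simp: continuous_on_eq_continuous_at)
  obtain d1 where d1: "d1 > 0" "\<And>y. dist y x < d1 \<Longrightarrow> \<bar>dder v (dder w f) y - dder v (dder w f) x\<bar> < e"
    using cont(1) e unfolding continuous_at_eps_delta dist_real_def by blast
  obtain d2 where d2: "d2 > 0" "\<And>y. dist y x < d2 \<Longrightarrow> \<bar>dder w (dder v f) y - dder w (dder v f) x\<bar> < e"
    using cont(2) e unfolding continuous_at_eps_delta dist_real_def by blast
  obtain d3 where d3: "d3 > 0" "\<And>y. dist y x < d3 \<Longrightarrow> y \<in> S"
    using open_S x by (metis open_dist)
  define d where "d = min d1 (min d2 d3)"
  \<comment> \<open>The parallelogram with sides s v and s w stays within d / 2 of x; the summand 1
    keeps the denominator positive when v = w = 0.\<close>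
  define s where "s = d / (2 * (norm v + norm w + 1))"
  have d: "d > 0" using d1 d2 d3 by (simp add: d_def)
  then have s: "s > 0" unfolding s_def by (intro divide_pos_pos) (auto intro: add_nonneg_pos)
  have close: "dist (x + a *\<^sub>R v + b *\<^sub>R w) x < d" if "0 \<le> a" "a \<le> s" "0 \<le> b" "b \<le> s" for a b
  proof -
    have "dist (x + a *\<^sub>R v + b *\<^sub>R w) x = norm (a *\<^sub>R v + b *\<^sub>R w)"
      by (simp add: dist_norm algebra_simps)
    also have "\<dots> \<le> a * norm v + b * norm w"
      using norm_triangle_ineq[of "a *\<^sub>R v" "b *\<^sub>R w"] that by simp
    also have "\<dots> \<le> s * norm v + s * norm w"
      using that by (intro add_mono mult_right_mono) auto
    also have "\<dots> \<le> s * (norm v + norm w + 1)" using s by (simp add: algebra_simps)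
    also have "\<dots> = d / 2"
      using add_nonneg_pos[of "norm v + norm w" 1] by (simp add: s_def field_simps)
    finally show ?thesis using d by simp
  qed
  have box: "x + a *\<^sub>R v + b *\<^sub>R w \<in> S" if "0 \<le> a" "a \<le> s" "0 \<le> b" "b \<le> s" for a b
    using d3(2) close[OF that] by (simp add: d_def)
  obtain a b where ab: "0 < a" "a < s" "0 < b" "b < s"
    "f (x + s *\<^sub>R v + s *\<^sub>R w) - f (x + s *\<^sub>R v) - f (x + s *\<^sub>R w) + f x
      = s * s * dder w (dder v f) (x + a *\<^sub>R v + b *\<^sub>R w)"
    using second_difference_mean_value[OF f s, of x v w] box by blast
  have box': "x + a *\<^sub>R w + b *\<^sub>R v \<in> S" if "0 \<le> a" "a \<le> s" "0 \<le> b" "b \<le> s" for a b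
    using box[of b a] that by (simp add: algebra_simps)
  obtain a' b' where ab': "0 < a'" "a' < s" "0 < b'" "b' < s"
    "f (x + s *\<^sub>R w + s *\<^sub>R v) - f (x + s *\<^sub>R w) - f (x + s *\<^sub>R v) + f x
      = s * s * dder v (dder w f) (x + a' *\<^sub>R w + b' *\<^sub>R v)"
    using second_difference_mean_value[OF f s, of x w v] box' by blast
  have "s * s * dder w (dder v f) (x + a *\<^sub>R v + b *\<^sub>R w)
      = s * s * dder v (dder w f) (x + a' *\<^sub>R w + b' *\<^sub>R v)"
    using ab(5) ab'(5) by (simp add: algebra_simps)
  then have eq: "dder w (dder v f) (x + a *\<^sub>R v + b *\<^sub>R w) = dder v (dder w f) (x + a' *\<^sub>R w + b' *\<^sub>R v)"
    using s by simp
  have "\<bar>dder w (dder v f) (x + a *\<^sub>R v + b *\<^sub>R w) - dder w (dder v f) x\<bar> < e"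
    using d2(2) close[of a b] ab by (simp add: d_def)
  moreover have "\<bar>dder v (dder w f) (x + a' *\<^sub>R w + b' *\<^sub>R v) - dder v (dder w f) x\<bar> < e"
    using d1(2) close[of b' a'] ab' by (simp add: d_def algebra_simps)
  ultimately show False using eq by (simp add: e_def abs_if field_simps split: if_splits)
qed

end

subsection \<open>Sums over indices and matrices\<close>

text \<open>The induction splits off the rank-one part H i k * H j k / H k k of H, as in a Cholesky decomposition.\<close>

lemma sum_pos_def_psd_nonneg:
  fixes H K :: "'i \<Rightarrow> 'i \<Rightarrow> real"
  assumes "finite I"
    and "\<And>i j. H i j = H j i"
    and "\<And>x. \<exists>i\<in>I. x i \<noteq> 0 \<Longrightarrow> (\<Sum>i\<in>I. \<Sum>j\<in>I. x i * x j * H i j) > 0"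
    and "\<And>x. (\<Sum>i\<in>I. \<Sum>j\<in>I. x i * x j * K i j) \<ge> 0"
  shows "(\<Sum>i\<in>I. \<Sum>j\<in>I. H i j * K i j) \<ge> 0"
  using assms
proof (induction I arbitrary: H rule: finite_induct)
  case (insert k F)
  note sym = insert.prems(1) and pos = insert.prems(2) and psd = insert.prems(3)
  have split: "(\<Sum>i\<in>insert k F. \<Sum>j\<in>insert k F. f i j)
      = f k k + (\<Sum>j\<in>F. f k j) + (\<Sum>i\<in>F. f i k) + (\<Sum>i\<in>F. \<Sum>j\<in>F. f i j)" for f :: "'i \<Rightarrow> 'i \<Rightarrow> real"
    using insert.hyps by (simp add: sum.distrib)
  have Hkk: "H k k > 0"
    using pos[of "\<lambda>i. if i = k then 1 else 0"] insert.hyps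
    by (simp add: if_distrib[of "\<lambda>x. x * _"] if_distrib[of "\<lambda>x. _ * x"] cong: if_cong)
  define H' where "H' i j = H i j - H i k * H j k / H k k" for i j
  have H'_k: "H' k j = 0" "H' j k = 0" for j
    using Hkk sym[of k j] by (simp_all add: H'_def)
  have pos': "(\<Sum>i\<in>F. \<Sum>j\<in>F. x i * x j * H' i j) > 0" if "\<exists>i\<in>F. x i \<noteq> 0" for x
  proof -
    define q where "q = (\<Sum>j\<in>F. x j * H j k)"
    \<comment> \<open>This value of the k-th coordinate minimises the quadratic form of
      \<open>H\<close> with the other coordinates fixed; the minimum is the form of the Schur
      complement \<open>H'\<close> at x.\<close>
    define y where "y = x(k := - q / H k k)"
    have y: "y i = x i" if "i \<in> F" for i using that insert.hyps by (auto simp: y_def)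
    have "\<exists>i\<in>insert k F. y i \<noteq> 0" using that y by fastforce
    then have "0 < (\<Sum>i\<in>insert k F. \<Sum>j\<in>insert k F. y i * y j * H i j)" by (rule pos)
    also have "\<dots> = y k * y k * H k k + y k * q + y k * q + (\<Sum>i\<in>F. \<Sum>j\<in>F. x i * x j * H i j)"
      unfolding split q_def sum_distrib_left using y
      by (intro arg_cong2[of _ _ _ _ "(+)"] sum.cong refl) (auto simp: sym[of k _])
    also have "\<dots> = (\<Sum>i\<in>F. \<Sum>j\<in>F. x i * x j * H i j) - q * q / H k k"
      using Hkk by (simp add: y_def field_simps)
    also have "q * q / H k k = (\<Sum>i\<in>F. \<Sum>j\<in>F. x i * x j * (H i k * H j k / H k k))"
      unfolding q_def sum_product sum_divide_distrib by (intro sum.cong refl) (simp add: mult_ac)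
    finally show ?thesis by (simp add: H'_def right_diff_distrib sum_subtractf)
  qed
  have psd': "(\<Sum>i\<in>F. \<Sum>j\<in>F. x i * x j * K i j) \<ge> 0" for x
  proof -
    let ?y = "x(k := 0)"
    have y: "?y i = x i" if "i \<in> F" for i using that insert.hyps by auto
    have "(\<Sum>i\<in>insert k F. \<Sum>j\<in>insert k F. ?y i * ?y j * K i j) = (\<Sum>i\<in>F. \<Sum>j\<in>F. ?y i * ?y j * K i j)"
      unfolding split by simp
    also have "\<dots> = (\<Sum>i\<in>F. \<Sum>j\<in>F. x i * x j * K i j)"
      by (intro sum.cong refl) (simp only: y)
    finally show ?thesis using psd[of ?y] by simp
  qed
  have "0 \<le> (\<Sum>i\<in>F. \<Sum>j\<in>F. H' i j * K i j)"
    by (rule insert.IH) (use pos' psd' sym in \<open>auto simp: H'_def mult.commute\<close>)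
  also have "\<dots> = (\<Sum>i\<in>insert k F. \<Sum>j\<in>insert k F. H' i j * K i j)"
    unfolding split by (simp add: H'_k)
  also have "\<dots> = (\<Sum>i\<in>insert k F. \<Sum>j\<in>insert k F. H i j * K i j)
      - (\<Sum>i\<in>insert k F. \<Sum>j\<in>insert k F. H i k * H j k * K i j) / H k k"
    unfolding H'_def left_diff_distrib sum_subtractf sum_divide_distrib
    by (intro arg_cong2[of _ _ _ _ "(-)"] sum.cong refl) simp
  \<comment> \<open>The rank-one part that was split off pairs with \<open>K\<close> to the value of
    the form of \<open>K\<close> at the k-th column of \<open>H\<close>, divided by
    \<open>H k k\<close>.\<close>
  finally show ?case
    using divide_nonneg_pos[OF psd[of "\<lambda>i. H i k"] Hkk] by simp
qed simp

text \<open>Nested sums are flattened to sums over tuples, so that renaming and reordering several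
  summation indices becomes one bijection of tuples.\<close>

lemma sum_3: "(\<Sum>i\<in>UNIV. \<Sum>j\<in>UNIV. \<Sum>k\<in>UNIV. f i j k)
    = (\<Sum>(i, j, k)\<in>(UNIV :: ('i::finite \<times> 'j::finite \<times> 'k::finite) set). f i j k)"
  by (simp add: sum.cartesian_product flip: UNIV_Times_UNIV)

lemma sum_4: "(\<Sum>i\<in>UNIV. \<Sum>j\<in>UNIV. \<Sum>k\<in>UNIV. \<Sum>m\<in>UNIV. f i j k m)
    = (\<Sum>(i, j, k, m)\<in>(UNIV :: ('i::finite \<times> 'j::finite \<times> 'k::finite \<times> 'l::finite) set). f i j k m)"
  by (simp add: sum.cartesian_product flip: UNIV_Times_UNIV)

lemma matrix_mult_minus_right: "A ** (- B) = - (A ** (B :: real^'p^'n))"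
  and matrix_mult_minus_left: "(- A) ** B = - (A ** (B :: real^'p^'n))"
  and matrix_mult_diff_right: "A ** (B - C) = A ** B - A ** (C :: real^'p^'n)"
  and matrix_mult_add_left: "(A + D) ** B = A ** B + D ** (B :: real^'p^'n)"
  and matrix_mult_diff_left: "(A - D) ** B = A ** B - D ** (B :: real^'p^'n)"
  by (simp_all add: matrix_matrix_mult_def vec_eq_iff sum_negf sum_subtractf sum.distrib algebra_simps)

lemma transpose_add: "transpose (A + B) = transpose A + transpose (B :: real^'p^'n)"
  and transpose_minus: "transpose (- A) = - transpose (A :: real^'p^'n)"
  and transpose_diff: "transpose (A - B) = transpose A - transpose (B :: real^'p^'n)"
  by (simp_all add: transpose_def vec_eq_iff)

lemmas matrix_ring_simps = matrix_mult_minus_right matrix_mult_minus_left matrix_mult_diff_right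
  matrix_mult_diff_left matrix_add_ldistrib matrix_mult_add_left matrix_mul_assoc
  transpose_add transpose_minus transpose_diff matrix_transpose_mul transpose_transpose

subsection \<open>Curvature identities in a chart\<close>

text \<open>
  S is a domain of space-time, e i are the coordinate directions of space, and h is the inverse
  of the matrix g.  In Gam and Rm the first index is the upper one; it is the row index in
  matGam and matRm.
\<close>

locale metric_calculus = open_set S for S :: "'a::real_normed_vector set" +
  fixes e :: "'n::finite \<Rightarrow> 'a"
    and g h :: "'n \<Rightarrow> 'n \<Rightarrow> 'a \<Rightarrow> real"
  assumes smooth_g [smooth_intros]: "smooth_on (g i j) S"
    and smooth_h [smooth_intros]: "smooth_on (h i j) S"
    and g_sym: "x \<in> S \<Longrightarrow> g i j x = g j i x"
    and h_sym: "x \<in> S \<Longrightarrow> h i j x = h j i x"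
    and h_g: "x \<in> S \<Longrightarrow> (\<Sum>k\<in>UNIV. h i k x * g k j x) = (if i = j then 1 else 0)"
begin

abbreviation pd :: "'n \<Rightarrow> ('a \<Rightarrow> real) \<Rightarrow> 'a \<Rightarrow> real" where
  "pd i \<equiv> dder (e i)"

definition Gam :: "'n \<Rightarrow> 'n \<Rightarrow> 'n \<Rightarrow> 'a \<Rightarrow> real" where
  "Gam k i j x = 1/2 * (\<Sum>l\<in>UNIV. h k l x * (pd i (g j l) x + pd j (g i l) x - pd l (g i j) x))"

definition Rm :: "'n \<Rightarrow> 'n \<Rightarrow> 'n \<Rightarrow> 'n \<Rightarrow> 'a \<Rightarrow> real" where
  "Rm l i j k x = pd i (Gam l j k) x - pd j (Gam l i k) x
     + (\<Sum>m\<in>UNIV. Gam m j k x * Gam l i m x - Gam m i k x * Gam l j m x)"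

definition Ric :: "'n \<Rightarrow> 'n \<Rightarrow> 'a \<Rightarrow> real" where
  "Ric j k x = (\<Sum>i\<in>UNIV. Rm i i j k x)"

definition Sc :: "'a \<Rightarrow> real" where
  "Sc x = (\<Sum>j\<in>UNIV. \<Sum>k\<in>UNIV. h j k x * Ric j k x)"

lemma smooth_Gam [smooth_intros]: "smooth_on (Gam k i j) S"
  unfolding Gam_def[abs_def] by (intro smooth_intros)

lemma smooth_Rm [smooth_intros]: "smooth_on (Rm l i j k) S"
  unfolding Rm_def[abs_def] by (intro smooth_intros)

lemma smooth_Ric [smooth_intros]: "smooth_on (Ric j k) S"
  unfolding Ric_def[abs_def] by (intro smooth_intros)

lemma smooth_Sc [smooth_intros]: "smooth_on Sc S"
  unfolding Sc_def[abs_def] by (intro smooth_intros)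

abbreviation matg :: "'a \<Rightarrow> real^'n^'n" where "matg x \<equiv> \<chi> i j. g i j x"
abbreviation math :: "'a \<Rightarrow> real^'n^'n" where "math x \<equiv> \<chi> i j. h i j x"
abbreviation dmatg :: "'a \<Rightarrow> 'a \<Rightarrow> real^'n^'n" where "dmatg v x \<equiv> \<chi> i j. dder v (g i j) x"
abbreviation dmath :: "'a \<Rightarrow> 'a \<Rightarrow> real^'n^'n" where "dmath v x \<equiv> \<chi> i j. dder v (h i j) x"
abbreviation matGam :: "'n \<Rightarrow> 'a \<Rightarrow> real^'n^'n" where "matGam i x \<equiv> \<chi> l k. Gam l i k x"
abbreviation dmatGam :: "'a \<Rightarrow> 'n \<Rightarrow> 'a \<Rightarrow> real^'n^'n" where
  "dmatGam v i x \<equiv> \<chi> l k. dder v (Gam l i k) x"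
abbreviation ddmatGam :: "'n \<Rightarrow> 'n \<Rightarrow> 'n \<Rightarrow> 'a \<Rightarrow> real^'n^'n" where
  "ddmatGam a i j x \<equiv> \<chi> l k. pd a (pd i (Gam l j k)) x"
abbreviation matRm :: "'n \<Rightarrow> 'n \<Rightarrow> 'a \<Rightarrow> real^'n^'n" where "matRm i j x \<equiv> \<chi> l k. Rm l i j k x"
abbreviation dmatRm :: "'n \<Rightarrow> 'n \<Rightarrow> 'n \<Rightarrow> 'a \<Rightarrow> real^'n^'n" where
  "dmatRm a i j x \<equiv> \<chi> l k. pd a (Rm l i j k) x"

context
  fixes x assumes x: "x \<in> S"
begin

lemma dder_g_sym: "dder v (g i j) x = dder v (g j i) x"
  by (rule dder_cong[OF open_S x smooth_g g_sym])

lemma Gam_sym: "Gam k i j x = Gam k j i x"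
  unfolding Gam_def by (simp add: dder_g_sym[of _ i j] add.commute)

lemma math_matg: "math x ** matg x = mat 1"
  by (simp add: matrix_matrix_mult_def mat_def vec_eq_iff h_g[OF x])

lemma matg_math: "matg x ** math x = mat 1"
  using math_matg matrix_left_right_inverse by blast

lemma transpose_math: "transpose (math x) = math x"
  by (simp add: transpose_def vec_eq_iff h_sym[OF x])

lemma transpose_matg: "transpose (matg x) = matg x"
  by (simp add: transpose_def vec_eq_iff g_sym[OF x])

lemma matg_matGam: "(matg x ** matGam i x) $ k $ j
    = 1/2 * (pd i (g j k) x + pd j (g i k) x - pd k (g i j) x)"
proof -
  define X where "X = (\<chi> k j. pd i (g j k) x + pd j (g i k) x - pd k (g i j) x)"
  have "matGam i x = (1/2) *\<^sub>R (math x ** X)"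
    by (simp add: vec_eq_iff matrix_matrix_mult_def X_def Gam_def)
  then have "matg x ** matGam i x = (1/2) *\<^sub>R (matg x ** (math x ** X))"
    by (simp add: matrix_scalar_ac scalar_matrix_assoc[symmetric])
  also have "\<dots> = (1/2) *\<^sub>R X"
    by (simp add: matrix_mul_assoc matg_math)
  finally show ?thesis by (simp add: X_def)
qed

text \<open>Metric compatibility of the Levi-Civita connection, nabla g = 0, in matrix form:
  lowering the upper index of the Christoffel symbols leaves first derivatives of g, and
  symmetrising them leaves a single one.\<close>

lemma dmatg_Gam: "dmatg (e i) x = transpose (matGam i x) ** matg x + matg x ** matGam i x"
proof -
  have "transpose (matGam i x) ** matg x = transpose (matg x ** matGam i x)"
    by (simp add: matrix_transpose_mul transpose_matg)
  then show ?thesis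
    by (simp add: vec_eq_iff transpose_def matg_matGam)
      (simp add: dder_g_sym[of "e i"] dder_g_sym[of _ _ i] field_simps)
qed

lemma dmath_dmatg: "dmath v x = - (math x ** dmatg v x ** math x)"
proof -
  have "(dmath v x ** matg x + math x ** dmatg v x) $ i $ j = 0" for i j
  proof -
    have "dder v (\<lambda>y. \<Sum>k\<in>UNIV. h i k y * g k j y) x = dder v (\<lambda>y. if i = j then 1 else 0) x"
      by (rule dder_cong[OF open_S x _ h_g]) (intro smooth_intros)
    then show ?thesis
      by (simp add: dder_rules x smooth_intros dder_const matrix_matrix_mult_def sum.distrib)
  qed
  then have "dmath v x ** matg x = - (math x ** dmatg v x)"
    by (simp add: vec_eq_iff eq_neg_iff_add_eq_0)
  then have "dmath v x ** matg x ** math x = - (math x ** dmatg v x) ** math x"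
    by simp
  then show ?thesis
    by (simp add: matrix_mul_assoc[symmetric] matg_math matrix_mult_minus_left)
qed

lemma dmath_Gam: "dmath (e i) x = - (math x ** transpose (matGam i x)) - matGam i x ** math x"
proof -
  have "dmath (e i) x = - (math x ** transpose (matGam i x) ** (matg x ** math x))
      - (math x ** matg x) ** matGam i x ** math x"
    unfolding dmath_dmatg dmatg_Gam by (simp add: matrix_ring_simps)
  then show ?thesis by (simp add: math_matg matg_math)
qed

text \<open>With the upper and the last lower index as matrix indices, curvature is F = d omega +
  omega wedge omega for the matrix-valued connection form omega. This turns the curvature identities
  below into computations in a noncommutative ring.\<close>

lemma matRm_eq: "matRm i j x = dmatGam (e i) j x - dmatGam (e j) i x
    + matGam i x ** matGam j x - matGam j x ** matGam i x"
  by (simp add: vec_eq_iff matrix_matrix_mult_def Rm_def sum_subtractf mult.commute)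

end

text \<open>Curvature is the commutator of covariant derivatives, and \<open>h\<close> is parallel.
  Expanding both mixed second derivatives of \<open>h\<close> through nabla h = 0 and equating them
  leaves the action of the curvature on \<open>h\<close>, which must vanish.\<close>

lemma matRm_antisym:
  assumes x: "x \<in> S"
  shows "matRm i j x ** math x = - (math x ** transpose (matRm i j x))"
proof -
  have dd: "(\<chi> a b. pd j (pd i (h a b)) x)
      = - (dmath (e j) x ** transpose (matGam i x)) - math x ** transpose (dmatGam (e j) i x)
        - dmatGam (e j) i x ** math x - matGam i x ** dmath (e j) x" for i j
  proof -
    have "pd i (h a b) y = - (\<Sum>m\<in>UNIV. h a m y * Gam b i m y) - (\<Sum>m\<in>UNIV. Gam a i m y * h m b y)"
      if "y \<in> S" for a b y
      using dmath_Gam[OF that, of i]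
      by (simp add: vec_eq_iff matrix_matrix_mult_def transpose_def)
    then have "pd j (pd i (h a b)) x
        = pd j (\<lambda>y. - (\<Sum>m\<in>UNIV. h a m y * Gam b i m y) - (\<Sum>m\<in>UNIV. Gam a i m y * h m b y)) x" for a b
      by (intro dder_cong[OF open_S x]) (auto intro: smooth_intros)
    then show ?thesis
      by (simp add: vec_eq_iff matrix_matrix_mult_def transpose_def dder_rules x smooth_intros sum.distrib)
  qed
  have "(\<chi> a b. pd j (pd i (h a b)) x) = (\<chi> a b. pd i (pd j (h a b)) x)"
    using dder_commute[OF smooth_h x] by (simp add: vec_eq_iff)
  then have "(dmatGam (e i) j x - dmatGam (e j) i x + matGam i x ** matGam j x - matGam j x ** matGam i x) ** math x
    = - (math x ** transpose (dmatGam (e i) j x - dmatGam (e j) i x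
        + matGam i x ** matGam j x - matGam j x ** matGam i x))"
    unfolding dd dmath_Gam[OF x] by (simp add: matrix_ring_simps) (simp add: algebra_simps)
  then show ?thesis unfolding matRm_eq[OF x] .
qed

text \<open>The identity dF + [omega, F] = 0. The Christoffel terms of a full covariant derivative
  that act on the form indices do not appear, since they cancel in the cyclic sum for a symmetric
  connection. In this form only the equality of mixed derivatives of the Christoffel symbols enters;
  the products cancel as noncommutative polynomials.\<close>

lemma second_bianchi:
  assumes x: "x \<in> S"
  shows "(dmatRm a i j x + matGam a x ** matRm i j x - matRm i j x ** matGam a x)
    + (dmatRm i j a x + matGam i x ** matRm j a x - matRm j a x ** matGam i x)
    + (dmatRm j a i x + matGam j x ** matRm a i x - matRm a i x ** matGam j x) = 0"
proof -
  have dR: "dmatRm a i j x = ddmatGam a i j x - ddmatGam a j i x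
      + matGam i x ** dmatGam (e a) j x + dmatGam (e a) i x ** matGam j x
      - matGam j x ** dmatGam (e a) i x - dmatGam (e a) j x ** matGam i x" for a i j
    unfolding Rm_def[abs_def]
    by (simp add: vec_eq_iff matrix_matrix_mult_def dder_rules x smooth_intros sum.distrib
        sum_subtractf mult.commute)
  have comm: "ddmatGam a i j x = ddmatGam i a j x" for a i j
    using dder_commute[OF smooth_Gam x] by (simp add: vec_eq_iff)
  show ?thesis
    unfolding dR matRm_eq[OF x] comm[of a i] comm[of j i] comm[of a j]
    by (simp add: matrix_ring_simps)
qed

end

section \<open>Evolution equation of the scalar curvature under Ricci flow\<close>

locale ricci_flow_calculus = metric_calculus S e g h
  for S :: "'a::real_normed_vector set" and e :: "'n::finite \<Rightarrow> 'a"
    and g h :: "'n \<Rightarrow> 'n \<Rightarrow> 'a \<Rightarrow> real" +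
  fixes \<tau> :: 'a
  assumes flow: "x \<in> S \<Longrightarrow> dder \<tau> (g i j) x = - 2 * Ric i j x"
begin

text \<open>The flow equation makes Ric a multiple of the time derivative of the symmetric matrix g,
  which takes the place of the first Bianchi identity.\<close>

lemma Ric_sym: "x \<in> S \<Longrightarrow> Ric i j x = Ric j i x"
  using flow[of x i j] flow[of x j i] dder_g_sym[of x \<tau> i j] by simp

lemma Rm_swap: "x \<in> S \<Longrightarrow> Rm l j i k x = - Rm l i j k x"
  by (simp add: Rm_def flip: sum_negf)

lemma pd_h:
  assumes x: "x \<in> S"
  shows "pd i (h j k) x = - (\<Sum>m\<in>UNIV. h j m x * Gam k i m x) - (\<Sum>m\<in>UNIV. Gam j i m x * h m k x)"
  using dmath_Gam[OF x, of i] by (simp add: vec_eq_iff matrix_matrix_mult_def transpose_def)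

text \<open>Once an index is raised, skew symmetry exchanges the free upper index with the
  contracted one, and the metric trace becomes the natural trace that defines Ric.\<close>

lemma h_contract_Rm:
  assumes x: "x \<in> S"
  shows "(\<Sum>j\<in>UNIV. \<Sum>k\<in>UNIV. h j k x * Rm i j a k x) = - (\<Sum>m\<in>UNIV. Ric a m x * h m i x)"
proof -
  have "(\<Sum>k\<in>UNIV. Rm i j a k x * h k m x) = - (\<Sum>k\<in>UNIV. h i k x * Rm m j a k x)" for j m
    using matRm_antisym[OF x, of j a] by (simp add: vec_eq_iff matrix_matrix_mult_def transpose_def)
  then have "(\<Sum>j\<in>UNIV. \<Sum>k\<in>UNIV. h j k x * Rm i j a k x) = (\<Sum>j\<in>UNIV. - (\<Sum>k\<in>UNIV. h i k x * Rm j j a k x))"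
    by (simp add: h_sym[OF x] mult.commute)
  also have "\<dots> = - (\<Sum>k\<in>UNIV. \<Sum>j\<in>UNIV. h i k x * Rm j j a k x)"
    by (subst sum.swap) (simp add: sum_negf)
  also have "\<dots> = - (\<Sum>m\<in>UNIV. Ric a m x * h m i x)"
    by (simp add: Ric_def sum_distrib_left mult.commute h_sym[OF x, of i])
  finally show ?thesis .
qed

text \<open>The left-hand side is the divergence of Ric with all Christoffel terms written out. In
  the second Bianchi identity the upper index is traced against \<open>i\<close> and the pair j, k
  against \<open>h\<close>: the first cyclic summand yields the derivative of the scalar curvature,
  and each of the other two yields minus the divergence.\<close>

lemma contracted_bianchi:
  assumes x: "x \<in> S"
  shows "(\<Sum>i\<in>UNIV. \<Sum>j\<in>UNIV. h i j x * (pd i (Ric j a) x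
      - (\<Sum>m\<in>UNIV. Gam m i j x * Ric m a x) - (\<Sum>m\<in>UNIV. Ric j m x * Gam m i a x)))
    = 1/2 * pd a Sc x"
proof -
  note sums3 = sum_distrib_left sum_distrib_right sum_3
  note sums4 = sum_distrib_left sum_distrib_right sum_4
  \<comment> \<open>The numbers 1, 2, 3 refer to the three cyclic summands: \<open>T\<close> is the
    derivative term, \<open>P\<close> with suffix a or b the product with the connection matrix on
    the left or on the right. \<open>A1\<close> to \<open>A4\<close> are the contractions to which
    all of them reduce.\<close>
  define T1 where "T1 = (\<Sum>i\<in>UNIV. \<Sum>j\<in>UNIV. \<Sum>k\<in>UNIV. h j k x * pd a (Rm i i j k) x)"
  define T2 where "T2 = (\<Sum>i\<in>UNIV. \<Sum>j\<in>UNIV. \<Sum>k\<in>UNIV. h j k x * pd i (Rm i j a k) x)"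
  define T3 where "T3 = (\<Sum>i\<in>UNIV. \<Sum>j\<in>UNIV. \<Sum>k\<in>UNIV. h j k x * pd j (Rm i a i k) x)"
  define P1a where "P1a = (\<Sum>i\<in>UNIV. \<Sum>j\<in>UNIV. \<Sum>k\<in>UNIV. h j k x * (\<Sum>m\<in>UNIV. Gam i a m x * Rm m i j k x))"
  define P1b where "P1b = (\<Sum>i\<in>UNIV. \<Sum>j\<in>UNIV. \<Sum>k\<in>UNIV. h j k x * (\<Sum>m\<in>UNIV. Rm i i j m x * Gam m a k x))"
  define P2a where "P2a = (\<Sum>i\<in>UNIV. \<Sum>j\<in>UNIV. \<Sum>k\<in>UNIV. h j k x * (\<Sum>m\<in>UNIV. Gam i i m x * Rm m j a k x))"
  define P2b where "P2b = (\<Sum>i\<in>UNIV. \<Sum>j\<in>UNIV. \<Sum>k\<in>UNIV. h j k x * (\<Sum>m\<in>UNIV. Rm i j a m x * Gam m i k x))"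
  define P3a where "P3a = (\<Sum>i\<in>UNIV. \<Sum>j\<in>UNIV. \<Sum>k\<in>UNIV. h j k x * (\<Sum>m\<in>UNIV. Gam i j m x * Rm m a i k x))"
  define P3b where "P3b = (\<Sum>i\<in>UNIV. \<Sum>j\<in>UNIV. \<Sum>k\<in>UNIV. h j k x * (\<Sum>m\<in>UNIV. Rm i a i m x * Gam m j k x))"
  define A1 where "A1 = (\<Sum>j\<in>UNIV. \<Sum>k\<in>UNIV. \<Sum>m\<in>UNIV. Gam j a m x * h m k x * Ric j k x)"
  define A2 where "A2 = (\<Sum>j\<in>UNIV. \<Sum>k\<in>UNIV. h j k x * pd j (Ric a k) x)"
  define A3 where "A3 = (\<Sum>k\<in>UNIV. \<Sum>i\<in>UNIV. \<Sum>m\<in>UNIV. Ric a k x * Gam k i m x * h m i x)"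
  define A4 where "A4 = (\<Sum>k\<in>UNIV. \<Sum>i\<in>UNIV. \<Sum>m\<in>UNIV. Ric a k x * h k m x * Gam i i m x)"
  have bianchi: "T1 + P1a - P1b + T2 + P2a - P2b + T3 + P3a - P3b = 0"
  proof -
    have "h j k x * pd a (Rm i i j k) x + h j k x * (\<Sum>m\<in>UNIV. Gam i a m x * Rm m i j k x)
        - h j k x * (\<Sum>m\<in>UNIV. Rm i i j m x * Gam m a k x)
        + h j k x * pd i (Rm i j a k) x + h j k x * (\<Sum>m\<in>UNIV. Gam i i m x * Rm m j a k x)
        - h j k x * (\<Sum>m\<in>UNIV. Rm i j a m x * Gam m i k x)
        + h j k x * pd j (Rm i a i k) x + h j k x * (\<Sum>m\<in>UNIV. Gam i j m x * Rm m a i k x)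
        - h j k x * (\<Sum>m\<in>UNIV. Rm i a i m x * Gam m j k x) = 0" for i j k
      using arg_cong[OF second_bianchi[OF x, of a i j], of "\<lambda>A. h j k x * A $ i $ k"]
      by (simp add: matrix_matrix_mult_def algebra_simps)
    then show ?thesis
      unfolding T1_def T2_def T3_def P1a_def P1b_def P2a_def P2b_def P3a_def P3b_def
      by (simp only: sum.distrib[symmetric] sum_subtractf[symmetric]) simp
  qed
  have pd_Ric: "pd v (Ric j k) x = (\<Sum>i\<in>UNIV. pd v (Rm i i j k) x)" for v j k
    unfolding Ric_def[abs_def] by (simp add: dder_sum x smooth_intros)
  have T1: "T1 = (\<Sum>j\<in>UNIV. \<Sum>k\<in>UNIV. h j k x * pd a (Ric j k) x)"
    unfolding T1_def pd_Ric sums3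
    by (rule sum.reindex_bij_witness[of _ "\<lambda>(j,k,i). (i,j,k)" "\<lambda>(i,j,k). (j,k,i)"]) auto
  have Sc: "pd a Sc x = T1 - 2 * A1"
  proof -
    have "pd a Sc x = T1 + (\<Sum>j\<in>UNIV. \<Sum>k\<in>UNIV. pd a (h j k) x * Ric j k x)"
      unfolding Sc_def[abs_def] T1 by (simp add: dder_rules x smooth_intros sum.distrib)
    also have "\<dots> = T1 - (\<Sum>j\<in>UNIV. \<Sum>k\<in>UNIV. \<Sum>m\<in>UNIV. h j m x * Gam k a m x * Ric j k x) - A1"
      by (simp add: pd_h[OF x] A1_def left_diff_distrib sum_subtractf sum_negf sum_distrib_right)
    also have "(\<Sum>j\<in>UNIV. \<Sum>k\<in>UNIV. \<Sum>m\<in>UNIV. h j m x * Gam k a m x * Ric j k x) = A1"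
      unfolding A1_def sums3
      by (rule sum.reindex_bij_witness[of _ "\<lambda>(j,k,m). (k,j,m)" "\<lambda>(j,k,m). (k,j,m)"])
        (auto simp: Ric_sym[OF x] h_sym[OF x])
    finally show ?thesis by simp
  qed
  have q: "(\<Sum>j\<in>UNIV. \<Sum>k\<in>UNIV. h j k x * Rm m i j k x) = (\<Sum>p\<in>UNIV. Ric i p x * h p m x)" for m i
  proof -
    have "(\<Sum>j\<in>UNIV. \<Sum>k\<in>UNIV. h j k x * Rm m i j k x) = - (\<Sum>j\<in>UNIV. \<Sum>k\<in>UNIV. h j k x * Rm m j i k x)"
      by (subst Rm_swap[OF x]) (simp add: sum_negf)
    then show ?thesis using h_contract_Rm[OF x] by simp
  qed
  have P1a: "P1a = A1"
  proof -
    have "P1a = (\<Sum>i\<in>UNIV. \<Sum>m\<in>UNIV. Gam i a m x * (\<Sum>j\<in>UNIV. \<Sum>k\<in>UNIV. h j k x * Rm m i j k x))"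
      unfolding P1a_def sums4
      by (rule sum.reindex_bij_witness[of _ "\<lambda>(i,m,j,k). (i,j,k,m)" "\<lambda>(i,j,k,m). (i,m,j,k)"]) auto
    also have "\<dots> = A1"
      unfolding q A1_def sums3
      by (rule sum.reindex_bij_witness[of _ "\<lambda>(j,k,m). (j,m,k)" "\<lambda>(j,m,k). (j,k,m)"])
        (auto simp: h_sym[OF x])
    finally show ?thesis .
  qed
  have P1b: "P1b = A1"
  proof -
    have "P1b = (\<Sum>j\<in>UNIV. \<Sum>k\<in>UNIV. \<Sum>m\<in>UNIV. h j k x * Ric j m x * Gam m a k x)"
      unfolding P1b_def Ric_def sums4
      by (rule sum.reindex_bij_witness[of _ "\<lambda>(j,k,m,i). (i,j,k,m)" "\<lambda>(i,j,k,m). (j,k,m,i)"]) auto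
    also have "\<dots> = A1"
      unfolding A1_def sums3
      by (rule sum.reindex_bij_witness[of _ "\<lambda>(m,j,k). (j,k,m)" "\<lambda>(j,k,m). (m,j,k)"])
        (auto simp: h_sym[OF x] Ric_sym[OF x])
    finally show ?thesis .
  qed
  have P2a: "P2a = - A4"
  proof -
    have "P2a = (\<Sum>i\<in>UNIV. \<Sum>m\<in>UNIV. Gam i i m x * (\<Sum>j\<in>UNIV. \<Sum>k\<in>UNIV. h j k x * Rm m j a k x))"
      unfolding P2a_def sums4
      by (rule sum.reindex_bij_witness[of _ "\<lambda>(i,m,j,k). (i,j,k,m)" "\<lambda>(i,j,k,m). (i,m,j,k)"]) auto
    also have "\<dots> = - (\<Sum>i\<in>UNIV. \<Sum>m\<in>UNIV. Gam i i m x * (\<Sum>p\<in>UNIV. Ric a p x * h p m x))"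
      unfolding h_contract_Rm[OF x] by (simp add: sum_negf)
    also have "(\<Sum>i\<in>UNIV. \<Sum>m\<in>UNIV. Gam i i m x * (\<Sum>p\<in>UNIV. Ric a p x * h p m x)) = A4"
      unfolding A4_def sums3
      by (rule sum.reindex_bij_witness[of _ "\<lambda>(k,i,m). (i,m,k)" "\<lambda>(i,m,k). (k,i,m)"]) auto
    finally show ?thesis .
  qed
  have T3: "T3 = - A2"
  proof -
    have "pd j (Rm i a i k) x = - pd j (Rm i i a k) x" for i j k
      using dder_cong[OF open_S x smooth_Rm, of i a i k "\<lambda>y. - Rm i i a k y" "e j", OF Rm_swap]
        dder_minus[OF x smooth_Rm, of "e j" i i a k] by simp
    then have "T3 = - (\<Sum>i\<in>UNIV. \<Sum>j\<in>UNIV. \<Sum>k\<in>UNIV. h j k x * pd j (Rm i i a k) x)"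
      by (simp add: T3_def sum_negf)
    also have "(\<Sum>i\<in>UNIV. \<Sum>j\<in>UNIV. \<Sum>k\<in>UNIV. h j k x * pd j (Rm i i a k) x) = A2"
      unfolding A2_def pd_Ric sums3
      by (rule sum.reindex_bij_witness[of _ "\<lambda>(j,k,i). (i,j,k)" "\<lambda>(i,j,k). (j,k,i)"]) auto
    finally show ?thesis .
  qed
  have P3b: "P3b = - A3"
  proof -
    have "P3b = - (\<Sum>i\<in>UNIV. \<Sum>j\<in>UNIV. \<Sum>k\<in>UNIV. h j k x * (\<Sum>m\<in>UNIV. Rm i i a m x * Gam m j k x))"
      unfolding P3b_def by (subst Rm_swap[OF x]) (simp add: sum_negf)
    also have "(\<Sum>i\<in>UNIV. \<Sum>j\<in>UNIV. \<Sum>k\<in>UNIV. h j k x * (\<Sum>m\<in>UNIV. Rm i i a m x * Gam m j k x)) = A3"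
      unfolding A3_def Ric_def sums4
      by (rule sum.reindex_bij_witness[of _ "\<lambda>(m,j,k,i). (i,j,k,m)" "\<lambda>(i,j,k,m). (m,j,k,i)"])
        (auto simp: h_sym[OF x])
    finally show ?thesis .
  qed
  \<comment> \<open>These three terms are evaluated together: \<open>T2\<close> has the contraction
    outside the derivative, so the identity \<open>h_contract_Rm\<close> is differentiated as a
    whole, and the derivatives of \<open>h\<close> that arise are exactly - \<open>P2b\<close> and
    \<open>P3a\<close>.\<close>
  have T2: "T2 - P2b + P3a = - A2 + A4 + A3"
  proof -
    have "(\<Sum>i\<in>UNIV. pd i (\<lambda>y. \<Sum>j\<in>UNIV. \<Sum>k\<in>UNIV. h j k y * Rm i j a k y) x)
        = (\<Sum>i\<in>UNIV. pd i (\<lambda>y. - (\<Sum>m\<in>UNIV. Ric a m y * h m i y)) x)"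
      by (intro sum.cong refl dder_cong[OF open_S x] h_contract_Rm smooth_intros)
    then have eq: "T2 + (\<Sum>i\<in>UNIV. \<Sum>j\<in>UNIV. \<Sum>k\<in>UNIV. pd i (h j k) x * Rm i j a k x)
        = - (\<Sum>i\<in>UNIV. \<Sum>m\<in>UNIV. pd i (Ric a m) x * h m i x) - (\<Sum>i\<in>UNIV. \<Sum>m\<in>UNIV. Ric a m x * pd i (h m i) x)"
      by (simp add: T2_def dder_rules x smooth_intros sum.distrib sum_negf sum_subtractf)
    have 1: "(\<Sum>i\<in>UNIV. \<Sum>j\<in>UNIV. \<Sum>k\<in>UNIV. pd i (h j k) x * Rm i j a k x)
        = - (\<Sum>i\<in>UNIV. \<Sum>j\<in>UNIV. \<Sum>k\<in>UNIV. \<Sum>m\<in>UNIV. h j m x * Gam k i m x * Rm i j a k x)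
          - (\<Sum>i\<in>UNIV. \<Sum>j\<in>UNIV. \<Sum>k\<in>UNIV. \<Sum>m\<in>UNIV. Gam j i m x * h m k x * Rm i j a k x)"
      by (simp add: pd_h[OF x] left_diff_distrib sum_subtractf sum_negf sum_distrib_right)
    have 2: "(\<Sum>i\<in>UNIV. \<Sum>j\<in>UNIV. \<Sum>k\<in>UNIV. \<Sum>m\<in>UNIV. h j m x * Gam k i m x * Rm i j a k x) = P2b"
      unfolding P2b_def sums4
      by (rule sum.reindex_bij_witness[of _ "\<lambda>(i,j,k,m). (i,j,m,k)" "\<lambda>(i,j,k,m). (i,j,m,k)"]) auto
    have 3: "(\<Sum>i\<in>UNIV. \<Sum>j\<in>UNIV. \<Sum>k\<in>UNIV. \<Sum>m\<in>UNIV. Gam j i m x * h m k x * Rm i j a k x) = - P3a"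
    proof -
      have "P3a = - (\<Sum>i\<in>UNIV. \<Sum>j\<in>UNIV. \<Sum>k\<in>UNIV. h j k x * (\<Sum>m\<in>UNIV. Gam i j m x * Rm m i a k x))"
        unfolding P3a_def by (subst Rm_swap[OF x]) (simp add: sum_negf)
      also have "(\<Sum>i\<in>UNIV. \<Sum>j\<in>UNIV. \<Sum>k\<in>UNIV. h j k x * (\<Sum>m\<in>UNIV. Gam i j m x * Rm m i a k x))
          = (\<Sum>i\<in>UNIV. \<Sum>j\<in>UNIV. \<Sum>k\<in>UNIV. \<Sum>m\<in>UNIV. Gam j i m x * h m k x * Rm i j a k x)"
        unfolding sums4
        by (rule sum.reindex_bij_witness[of _ "\<lambda>(i,j,k,m). (j,m,k,i)" "\<lambda>(j,m,k,i). (i,j,k,m)"])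
          (use Gam_sym[OF x] in auto)
      finally show ?thesis by simp
    qed
    have 4: "(\<Sum>i\<in>UNIV. \<Sum>m\<in>UNIV. pd i (Ric a m) x * h m i x) = A2"
      by (simp add: A2_def h_sym[OF x] mult.commute)
    have 5: "(\<Sum>i\<in>UNIV. \<Sum>m\<in>UNIV. Ric a m x * pd i (h m i) x)
        = - (\<Sum>i\<in>UNIV. \<Sum>m\<in>UNIV. \<Sum>p\<in>UNIV. Ric a m x * h m p x * Gam i i p x)
          - (\<Sum>i\<in>UNIV. \<Sum>m\<in>UNIV. \<Sum>p\<in>UNIV. Ric a m x * Gam m i p x * h p i x)"
      by (simp add: pd_h[OF x] right_diff_distrib sum_subtractf sum_negf sum_distrib_left mult.assoc)
    have 6: "(\<Sum>i\<in>UNIV. \<Sum>m\<in>UNIV. \<Sum>p\<in>UNIV. Ric a m x * h m p x * Gam i i p x) = A4"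
      unfolding A4_def by (rule sum.swap)
    have 7: "(\<Sum>i\<in>UNIV. \<Sum>m\<in>UNIV. \<Sum>p\<in>UNIV. Ric a m x * Gam m i p x * h p i x) = A3"
      unfolding A3_def by (rule sum.swap)
    show ?thesis using eq unfolding 1 2 3 4 5 6 7 by simp
  qed
  have "(\<Sum>i\<in>UNIV. \<Sum>j\<in>UNIV. h i j x * (pd i (Ric j a) x
      - (\<Sum>m\<in>UNIV. Gam m i j x * Ric m a x) - (\<Sum>m\<in>UNIV. Ric j m x * Gam m i a x)))
    = (\<Sum>i\<in>UNIV. \<Sum>j\<in>UNIV. h i j x * pd i (Ric j a) x)
      - (\<Sum>i\<in>UNIV. \<Sum>j\<in>UNIV. \<Sum>m\<in>UNIV. h i j x * (Gam m i j x * Ric m a x))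
      - (\<Sum>i\<in>UNIV. \<Sum>j\<in>UNIV. \<Sum>m\<in>UNIV. h i j x * (Ric j m x * Gam m i a x))"
    by (simp add: right_diff_distrib sum_subtractf sum_distrib_left)
  also have "(\<Sum>i\<in>UNIV. \<Sum>j\<in>UNIV. h i j x * pd i (Ric j a) x) = A2"
    unfolding A2_def
    by (intro sum.cong refl arg_cong2[of _ _ _ _ "(*)"] dder_cong[OF open_S x smooth_Ric] Ric_sym)
  also have "(\<Sum>i\<in>UNIV. \<Sum>j\<in>UNIV. \<Sum>m\<in>UNIV. h i j x * (Gam m i j x * Ric m a x)) = A3"
    unfolding A3_def sums3
    by (rule sum.reindex_bij_witness[of _ "\<lambda>(m,i,j). (i,j,m)" "\<lambda>(i,j,m). (m,i,j)"])
      (auto simp: h_sym[OF x] Ric_sym[OF x])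
  also have "(\<Sum>i\<in>UNIV. \<Sum>j\<in>UNIV. \<Sum>m\<in>UNIV. h i j x * (Ric j m x * Gam m i a x)) = A1"
    unfolding A1_def sums3
    by (rule sum.reindex_bij_witness[of _ "\<lambda>(m,j,i). (i,j,m)" "\<lambda>(i,j,m). (m,j,i)"])
      (use Gam_sym[OF x] in \<open>auto simp: h_sym[OF x] Ric_sym[OF x]\<close>)
  finally show ?thesis using bianchi Sc P1a P1b P2a P3b T2 T3 by simp
qed

lemma Sc_flow:
  assumes x: "x \<in> S"
  shows "Sc x = - (1/2) * (\<Sum>i\<in>UNIV. \<Sum>j\<in>UNIV. h i j x * dder \<tau> (g i j) x)"
  by (simp add: Sc_def flow[OF x] sum_distrib_left)

text \<open>By Jacobi's formula the right-hand side is the logarithmic derivative of the volume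
  density; keeping it as a trace avoids differentiating determinants. The trace of metric
  compatibility gives it, as both summands contribute equally.\<close>

lemma Gam_trace:
  assumes x: "x \<in> S"
  shows "(\<Sum>i\<in>UNIV. Gam i i k x) = 1/2 * (\<Sum>i\<in>UNIV. \<Sum>j\<in>UNIV. h i j x * pd k (g i j) x)"
proof -
  have tr: "trace (math x ** dmatg (e k) x) = (\<Sum>i\<in>UNIV. \<Sum>j\<in>UNIV. h i j x * pd k (g i j) x)"
    by (simp add: trace_def matrix_matrix_mult_def dder_g_sym[OF x])
  have "trace (math x ** dmatg (e k) x)
      = trace (math x ** (transpose (matGam k x) ** matg x)) + trace (math x ** matg x ** matGam k x)"
    unfolding dmatg_Gam[OF x] by (simp add: matrix_add_ldistrib trace_add matrix_mul_assoc)
  also have "trace (math x ** (transpose (matGam k x) ** matg x)) = trace (transpose (matGam k x))"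
    by (subst trace_mul_sym) (simp add: matrix_mul_assoc[symmetric] matg_math[OF x])
  finally have "trace (math x ** dmatg (e k) x) = 2 * (\<Sum>i\<in>UNIV. Gam i k i x)"
    by (simp add: math_matg[OF x] trace_def transpose_def)
  then show ?thesis using tr Gam_sym[OF x] by simp
qed

text \<open>Morally the time derivative and the k-th derivative of log (det g) / 2 commute, and the
  time derivative alone is - R. With traces in place of log det, the mixed derivatives of g agree,
  and the terms in which \<open>h\<close> is differentiated agree because the trace of (h dg)(h d'g)
  is symmetric in the two directions (\<open>dot\<close>).\<close>

lemma dder_Gam_trace:
  assumes x: "x \<in> S"
  shows "(\<Sum>i\<in>UNIV. dder \<tau> (Gam i i k) x) = - pd k Sc x"
proof -
  have dot: "(\<Sum>i\<in>UNIV. \<Sum>j\<in>UNIV. dder v (h i j) x * dder w (g i j) x)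
      = - trace ((math x ** dmatg v x) ** (math x ** dmatg w x))" for v w
  proof -
    have "(\<Sum>i\<in>UNIV. \<Sum>j\<in>UNIV. dder v (h i j) x * dder w (g i j) x) = trace (dmath v x ** dmatg w x)"
      by (simp add: trace_def matrix_matrix_mult_def dder_g_sym[OF x])
    also have "\<dots> = - trace ((math x ** dmatg v x) ** (math x ** dmatg w x))"
      unfolding dmath_dmatg[OF x]
      by (simp add: matrix_mult_minus_left matrix_mul_assoc) (simp add: trace_def sum_negf)
    finally show ?thesis .
  qed
  have comm: "dder \<tau> (pd k (g i j)) x = pd k (dder \<tau> (g i j)) x" for i j
    by (rule dder_commute[OF smooth_g x])
  have "(\<Sum>i\<in>UNIV. dder \<tau> (Gam i i k) x) = dder \<tau> (\<lambda>y. \<Sum>i\<in>UNIV. Gam i i k y) x"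
    by (simp add: dder_sum x smooth_intros)
  also have "\<dots> = dder \<tau> (\<lambda>y. 1/2 * (\<Sum>i\<in>UNIV. \<Sum>j\<in>UNIV. h i j y * pd k (g i j) y)) x"
    by (intro dder_cong[OF open_S x] Gam_trace smooth_intros)
  also have "\<dots> = 1/2 * ((\<Sum>i\<in>UNIV. \<Sum>j\<in>UNIV. h i j x * pd k (dder \<tau> (g i j)) x)
      + (\<Sum>i\<in>UNIV. \<Sum>j\<in>UNIV. dder \<tau> (h i j) x * pd k (g i j) x))"
    by (simp only: dder_cmult dder_mult dder_sum x smooth_intros) (simp add: sum.distrib comm)
  also have "(\<Sum>i\<in>UNIV. \<Sum>j\<in>UNIV. dder \<tau> (h i j) x * pd k (g i j) x)
      = (\<Sum>i\<in>UNIV. \<Sum>j\<in>UNIV. pd k (h i j) x * dder \<tau> (g i j) x)"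
    unfolding dot by (subst trace_mul_sym) simp
  also have "1/2 * ((\<Sum>i\<in>UNIV. \<Sum>j\<in>UNIV. h i j x * pd k (dder \<tau> (g i j)) x) + \<dots>)
      = - pd k (\<lambda>y. - (1/2) * (\<Sum>i\<in>UNIV. \<Sum>j\<in>UNIV. h i j y * dder \<tau> (g i j) y)) x"
    by (simp only: dder_cmult dder_mult dder_sum x smooth_intros) (simp add: sum.distrib)
  also have "pd k (\<lambda>y. - (1/2) * (\<Sum>i\<in>UNIV. \<Sum>j\<in>UNIV. h i j y * dder \<tau> (g i j) y)) x = pd k Sc x"
    by (rule dder_cong[OF open_S x smooth_Sc, symmetric]) (rule Sc_flow)
  finally show ?thesis .
qed

text \<open>Differentiating metric compatibility in time expresses the variation of the Christoffel
  symbols through - 2 nabla Ric (fact \<open>C\<close>). Tracing it gives two contractions of this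
  variation with sum - dR, by the contracted Bianchi identity. The second contraction alone is - dR
  by \<open>dder_Gam_trace\<close>, so the first one vanishes; inverting g then raises its
  index.\<close>

lemma h_contract_dder_Gam:
  assumes x: "x \<in> S"
  shows "(\<Sum>i\<in>UNIV. \<Sum>j\<in>UNIV. h i j x * dder \<tau> (Gam b i j) x) = 0"
proof -
  note sums3 = sum_distrib_left sum_distrib_right sum_3
  let ?C = "\<lambda>k i j. dder \<tau> (Gam k i j) x"
  have C: "(\<Sum>m\<in>UNIV. ?C m i j * g m a x) + (\<Sum>m\<in>UNIV. g j m x * ?C m i a)
      = - 2 * (pd i (Ric j a) x - (\<Sum>m\<in>UNIV. Gam m i j x * Ric m a x) - (\<Sum>m\<in>UNIV. Ric j m x * Gam m i a x))"
    for i j a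
  proof -
    have "pd i (dder \<tau> (g j a)) x = pd i (\<lambda>y. - 2 * Ric j a y) x"
      by (intro dder_cong[OF open_S x] flow smooth_intros)
    also have "pd i (dder \<tau> (g j a)) x = dder \<tau> (pd i (g j a)) x"
      by (rule dder_commute[OF smooth_g x])
    also have "\<dots> = dder \<tau> (\<lambda>y. (\<Sum>m\<in>UNIV. Gam m i j y * g m a y) + (\<Sum>m\<in>UNIV. g j m y * Gam m i a y)) x"
      by (intro dder_cong[OF open_S x] smooth_intros)
        (use dmatg_Gam in \<open>simp add: vec_eq_iff matrix_matrix_mult_def transpose_def\<close>)
    finally show ?thesis
      by (simp add: dder_rules x smooth_intros flow[OF x] sum.distrib sum_negf sum_distrib_left)
        (simp add: algebra_simps sum_subtractf)
  qed
  have "(\<Sum>i\<in>UNIV. \<Sum>j\<in>UNIV. h i j x * ((\<Sum>m\<in>UNIV. ?C m i j * g m a x) + (\<Sum>m\<in>UNIV. g j m x * ?C m i a)))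
      = - 2 * (1/2 * pd a Sc x)" for a
    unfolding contracted_bianchi[OF x, symmetric] C
    by (subst sum_distrib_left, subst sum_distrib_left) (intro sum.cong refl mult.left_commute)
  then have eq: "(\<Sum>i\<in>UNIV. \<Sum>j\<in>UNIV. h i j x * (\<Sum>m\<in>UNIV. ?C m i j * g m a x))
      + (\<Sum>i\<in>UNIV. \<Sum>j\<in>UNIV. h i j x * (\<Sum>m\<in>UNIV. g j m x * ?C m i a)) = - pd a Sc x" for a
    by (simp add: distrib_left sum.distrib)
  have "(\<Sum>i\<in>UNIV. \<Sum>j\<in>UNIV. h i j x * (\<Sum>m\<in>UNIV. g j m x * ?C m i a)) = (\<Sum>i\<in>UNIV. ?C i i a)" for a
  proof -
    have "(\<Sum>j\<in>UNIV. h i j x * (\<Sum>m\<in>UNIV. g j m x * ?C m i a))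
        = (\<Sum>m\<in>UNIV. (\<Sum>j\<in>UNIV. h i j x * g j m x) * ?C m i a)" for i
      unfolding sum_distrib_left sum_distrib_right mult.assoc by (rule sum.swap)
    then show ?thesis by (simp add: h_g[OF x] if_distrib[of "\<lambda>z. z * _"] cong: if_cong)
  qed
  then have w: "(\<Sum>i\<in>UNIV. \<Sum>j\<in>UNIV. h i j x * (\<Sum>m\<in>UNIV. ?C m i j * g m a x)) = 0" for a
    using eq[of a] dder_Gam_trace[OF x, of a] by simp
  define W where "W m = (\<Sum>i\<in>UNIV. \<Sum>j\<in>UNIV. h i j x * ?C m i j)" for m
  have "(\<Sum>m\<in>UNIV. W m * g m a x) = 0" for a
    unfolding w[of a, symmetric] W_def sums3
    by (rule sum.reindex_bij_witness[of _ "\<lambda>(i,j,m). (m,i,j)" "\<lambda>(m,i,j). (i,j,m)"]) auto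
  then have "0 = (\<Sum>a\<in>UNIV. (\<Sum>m\<in>UNIV. W m * g m a x) * h a b x)" by simp
  also have "\<dots> = (\<Sum>m\<in>UNIV. W m * (\<Sum>a\<in>UNIV. g m a x * h a b x))"
    unfolding sum_distrib_left sum_distrib_right mult.assoc by (rule sum.swap)
  also have "\<dots> = W b"
    using matg_math[OF x]
    by (simp add: vec_eq_iff matrix_matrix_mult_def mat_def if_distrib[of "\<lambda>z. _ * z"] cong: if_cong)
  finally show ?thesis by (simp add: W_def)
qed

definition Lap :: "('a \<Rightarrow> real) \<Rightarrow> 'a \<Rightarrow> real" where
  "Lap f x = (\<Sum>j\<in>UNIV. \<Sum>k\<in>UNIV. h j k x * (pd j (pd k f) x - (\<Sum>m\<in>UNIV. Gam m j k x * pd m f x)))"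

text \<open>The traced Palatini identity, with partial derivatives in \<open>U1\<close>,
  \<open>U2\<close> and Christoffel products in \<open>X1\<close> to \<open>X4\<close>. The part of
  the divergence that comes from the vanishing contraction disappears: \<open>X1\<close> is zero,
  and \<open>U1\<close> equals \<open>X3\<close> + \<open>X4\<close> because the derivatives of
  \<open>h\<close> produce exactly these products. The remainder, \<open>X2\<close> -
  \<open>U2\<close>, is the trace of the Hessian of the scalar curvature.\<close>

lemma h_contract_dder_Ric:
  assumes x: "x \<in> S"
  shows "(\<Sum>j\<in>UNIV. \<Sum>k\<in>UNIV. h j k x * dder \<tau> (Ric j k) x) = Lap Sc x"
proof -
  note sums3 = sum_distrib_left sum_distrib_right sum_3
  note sums4 = sum_distrib_left sum_distrib_right sum_4
  let ?C = "\<lambda>k i j. dder \<tau> (Gam k i j)"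
  define U1 where "U1 = (\<Sum>j\<in>UNIV. \<Sum>k\<in>UNIV. \<Sum>i\<in>UNIV. h j k x * pd i (?C i j k) x)"
  define U2 where "U2 = (\<Sum>j\<in>UNIV. \<Sum>k\<in>UNIV. \<Sum>i\<in>UNIV. h j k x * pd j (?C i i k) x)"
  define X1 where "X1 = (\<Sum>j\<in>UNIV. \<Sum>k\<in>UNIV. \<Sum>i\<in>UNIV. \<Sum>m\<in>UNIV. h j k x * (?C m j k x * Gam i i m x))"
  define X2 where "X2 = (\<Sum>j\<in>UNIV. \<Sum>k\<in>UNIV. \<Sum>i\<in>UNIV. \<Sum>m\<in>UNIV. h j k x * (Gam m j k x * ?C i i m x))"
  define X3 where "X3 = (\<Sum>j\<in>UNIV. \<Sum>k\<in>UNIV. \<Sum>i\<in>UNIV. \<Sum>m\<in>UNIV. h j k x * (?C m i k x * Gam i j m x))"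
  define X4 where "X4 = (\<Sum>j\<in>UNIV. \<Sum>k\<in>UNIV. \<Sum>i\<in>UNIV. \<Sum>m\<in>UNIV. h j k x * (Gam m i k x * ?C i j m x))"
  have "dder \<tau> (Ric j k) x = (\<Sum>i\<in>UNIV. pd i (?C i j k) x - pd j (?C i i k) x
      + (\<Sum>m\<in>UNIV. ?C m j k x * Gam i i m x + Gam m j k x * ?C i i m x
          - ?C m i k x * Gam i j m x - Gam m i k x * ?C i j m x))" for j k
    unfolding Ric_def[abs_def] Rm_def[abs_def]
    by (simp add: dder_rules x smooth_intros dder_commute[OF smooth_Gam x, of \<tau>])
      (simp add: algebra_simps)
  then have lhs: "(\<Sum>j\<in>UNIV. \<Sum>k\<in>UNIV. h j k x * dder \<tau> (Ric j k) x) = U1 - U2 + X1 + X2 - X3 - X4"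
    unfolding U1_def U2_def X1_def X2_def X3_def X4_def
    by (simp add: sum.distrib sum_subtractf sum_distrib_left distrib_left right_diff_distrib)
  have X1: "X1 = 0"
  proof -
    have "X1 = (\<Sum>i\<in>UNIV. \<Sum>m\<in>UNIV. (\<Sum>j\<in>UNIV. \<Sum>k\<in>UNIV. h j k x * ?C m j k x) * Gam i i m x)"
      unfolding X1_def sums4
      by (rule sum.reindex_bij_witness[of _ "\<lambda>(i,m,j,k). (j,k,i,m)" "\<lambda>(j,k,i,m). (i,m,j,k)"]) auto
    then show ?thesis by (simp add: h_contract_dder_Gam[OF x])
  qed
  have U1: "U1 = X3 + X4"
  proof -
    have "(\<Sum>i\<in>UNIV. pd i (\<lambda>y. \<Sum>j\<in>UNIV. \<Sum>k\<in>UNIV. h j k y * ?C i j k y) x) = (\<Sum>i\<in>UNIV. pd i (\<lambda>y. 0) x)"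
      by (intro sum.cong refl dder_cong[OF open_S x] h_contract_dder_Gam smooth_intros)
    then have eq: "(\<Sum>i\<in>UNIV. \<Sum>j\<in>UNIV. \<Sum>k\<in>UNIV. h j k x * pd i (?C i j k) x)
        + (\<Sum>i\<in>UNIV. \<Sum>j\<in>UNIV. \<Sum>k\<in>UNIV. pd i (h j k) x * ?C i j k x) = 0"
      by (simp add: dder_rules x smooth_intros sum.distrib dder_const)
    have 1: "(\<Sum>i\<in>UNIV. \<Sum>j\<in>UNIV. \<Sum>k\<in>UNIV. h j k x * pd i (?C i j k) x) = U1"
      unfolding U1_def sums3
      by (rule sum.reindex_bij_witness[of _ "\<lambda>(j,k,i). (i,j,k)" "\<lambda>(i,j,k). (j,k,i)"]) auto
    have 2: "(\<Sum>i\<in>UNIV. \<Sum>j\<in>UNIV. \<Sum>k\<in>UNIV. pd i (h j k) x * ?C i j k x)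
        = - (\<Sum>i\<in>UNIV. \<Sum>j\<in>UNIV. \<Sum>k\<in>UNIV. \<Sum>m\<in>UNIV. h j m x * Gam k i m x * ?C i j k x)
          - (\<Sum>i\<in>UNIV. \<Sum>j\<in>UNIV. \<Sum>k\<in>UNIV. \<Sum>m\<in>UNIV. Gam j i m x * h m k x * ?C i j k x)"
      by (simp add: pd_h[OF x] left_diff_distrib sum_subtractf sum_negf sum_distrib_right)
    have 3: "(\<Sum>i\<in>UNIV. \<Sum>j\<in>UNIV. \<Sum>k\<in>UNIV. \<Sum>m\<in>UNIV. h j m x * Gam k i m x * ?C i j k x) = X4"
      unfolding X4_def sums4
      by (rule sum.reindex_bij_witness[of _ "\<lambda>(j,k,i,m). (i,j,m,k)" "\<lambda>(i,j,k,m). (j,m,i,k)"]) auto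
    have 4: "(\<Sum>i\<in>UNIV. \<Sum>j\<in>UNIV. \<Sum>k\<in>UNIV. \<Sum>m\<in>UNIV. Gam j i m x * h m k x * ?C i j k x) = X3"
      unfolding X3_def sums4
      by (rule sum.reindex_bij_witness[of _ "\<lambda>(m,k,j,i). (i,j,k,m)" "\<lambda>(i,j,k,m). (m,k,j,i)"])
        (use Gam_sym[OF x] in auto)
    show ?thesis using eq unfolding 1 2 3 4 by simp
  qed
  have U2: "U2 = - (\<Sum>j\<in>UNIV. \<Sum>k\<in>UNIV. h j k x * pd j (pd k Sc) x)"
  proof -
    have "(\<Sum>i\<in>UNIV. pd j (?C i i k) x) = - pd j (pd k Sc) x" for j k
    proof -
      have "pd j (\<lambda>y. \<Sum>i\<in>UNIV. ?C i i k y) x = pd j (\<lambda>y. - pd k Sc y) x"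
        by (intro dder_cong[OF open_S x] dder_Gam_trace smooth_intros)
      then show ?thesis by (simp add: dder_rules x smooth_intros)
    qed
    then show ?thesis by (simp add: U2_def sum_distrib_left[symmetric] sum_negf)
  qed
  have X2: "X2 = - (\<Sum>j\<in>UNIV. \<Sum>k\<in>UNIV. \<Sum>m\<in>UNIV. h j k x * (Gam m j k x * pd m Sc x))"
  proof -
    have "X2 = (\<Sum>j\<in>UNIV. \<Sum>k\<in>UNIV. \<Sum>m\<in>UNIV. h j k x * (Gam m j k x * (\<Sum>i\<in>UNIV. ?C i i m x)))"
      unfolding X2_def sum_distrib_left by (rule sum.cong[OF refl sum.cong[OF refl sum.swap]])
    then show ?thesis by (simp add: dder_Gam_trace[OF x] sum_negf)
  qed
  show ?thesis
    unfolding lhs X1 U1 U2 X2 Lap_def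
    by (simp add: right_diff_distrib sum_subtractf sum_distrib_left)
qed

abbreviation matRic :: "'a \<Rightarrow> real^'n^'n" where "matRic x \<equiv> \<chi> i j. Ric i j x"

text \<open>The trace on the right is |Ric|^2. It comes entirely from the time derivative of the
  inverse metric, which is 2 Ric with both indices raised.\<close>

theorem scalar_curvature_evolution:
  assumes x: "x \<in> S"
  shows "dder \<tau> Sc x = Lap Sc x + 2 * trace (math x ** matRic x ** (math x ** matRic x))"
proof -
  have "dmatg \<tau> x = (-2) *\<^sub>R matRic x" by (simp add: vec_eq_iff flow[OF x])
  then have dh: "dmath \<tau> x = 2 *\<^sub>R (math x ** matRic x ** math x)"
    unfolding dmath_dmatg[OF x]
    by (simp add: matrix_matrix_mult_def vec_eq_iff sum_distrib_left sum_distrib_right sum_negf mult_ac)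
  have "dder \<tau> Sc x = Lap Sc x + (\<Sum>j\<in>UNIV. \<Sum>k\<in>UNIV. dder \<tau> (h j k) x * Ric j k x)"
  proof -
    have "dder \<tau> Sc x = dder \<tau> (\<lambda>y. \<Sum>j\<in>UNIV. \<Sum>k\<in>UNIV. h j k y * Ric j k y) x"
      by (simp add: Sc_def[abs_def])
    then show ?thesis
      unfolding h_contract_dder_Ric[OF x, symmetric]
      by (simp add: dder_rules x smooth_intros sum.distrib)
  qed
  also have "(\<Sum>j\<in>UNIV. \<Sum>k\<in>UNIV. dder \<tau> (h j k) x * Ric j k x) = trace (dmath \<tau> x ** matRic x)"
    by (simp add: trace_def matrix_matrix_mult_def) (simp add: Ric_sym[OF x])
  also have "\<dots> = 2 * trace (math x ** matRic x ** (math x ** matRic x))"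
    unfolding dh by (simp add: scalar_matrix_assoc[symmetric] matrix_mul_assoc)
      (simp add: trace_def sum_distrib_left)
  finally show ?thesis .
qed

text \<open>Cauchy-Schwarz for the trace of Ric, without an orthonormal frame. For B = Ric - (R/n)
  g, the quantity |B|^2 = |Ric|^2 - R^2 / n is the pairing of \<open>h\<close> with
  \<open>K\<close>, and \<open>K\<close> is positive semidefinite because its form at v is the form
  of \<open>h\<close> at B v.\<close>

lemma norm_Ric_ge:
  assumes x: "x \<in> S"
    and pos: "\<And>v. \<exists>i. v i \<noteq> 0 \<Longrightarrow> (\<Sum>i\<in>UNIV. \<Sum>j\<in>UNIV. v i * v j * h i j x) > 0"
  shows "(Sc x)\<^sup>2 \<le> real CARD('n) * trace (math x ** matRic x ** (math x ** matRic x))"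
proof -
  define c where "c = Sc x / real CARD('n)"
  \<comment> \<open>the trace-free part of the Ricci tensor, whose norm is nonnegative\<close>
  define B where "B = matRic x - c *\<^sub>R matg x"
  define K where "K = B ** math x ** B"
  have symB: "B $ i $ j = B $ j $ i" for i j
    by (simp add: B_def Ric_sym[OF x, of i j] g_sym[OF x, of i j])
  have psd: "(\<Sum>i\<in>UNIV. \<Sum>j\<in>UNIV. v i * v j * K $ i $ j) \<ge> 0" for v
  proof -
    define u where "u k = (\<Sum>i\<in>UNIV. v i * B $ i $ k)" for k
    have "(\<Sum>i\<in>UNIV. \<Sum>j\<in>UNIV. v i * v j * K $ i $ j) = (\<Sum>k\<in>UNIV. \<Sum>l\<in>UNIV. u k * u l * h k l x)"
    proof -
      have "(\<Sum>i\<in>UNIV. \<Sum>j\<in>UNIV. v i * v j * K $ i $ j)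
          = (\<Sum>i\<in>UNIV. \<Sum>j\<in>UNIV. \<Sum>l\<in>UNIV. \<Sum>k\<in>UNIV. v i * (v j * (B $ i $ k * h k l x * B $ l $ j)))"
        by (simp add: K_def matrix_matrix_mult_def sum_distrib_left sum_distrib_right mult.assoc)
      also have "\<dots> = (\<Sum>k\<in>UNIV. \<Sum>l\<in>UNIV. \<Sum>i\<in>UNIV. \<Sum>j\<in>UNIV. (v i * B $ i $ k) * (v j * B $ j $ l) * h k l x)"
        unfolding sum_4
        by (rule sum.reindex_bij_witness[of _ "\<lambda>(k,l,i,j). (i,j,l,k)" "\<lambda>(i,j,l,k). (k,l,i,j)"])
          (auto simp: symB)
      finally show ?thesis unfolding u_def sum_product by (simp only: sum_distrib_right)
    qed
    also have "\<dots> \<ge> 0"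
    proof (cases "\<exists>i. u i \<noteq> 0")
      case True
      then show ?thesis using pos[of u] by simp
    qed simp
    finally show ?thesis .
  qed
  have "0 \<le> (\<Sum>i\<in>UNIV. \<Sum>j\<in>UNIV. h i j x * K $ i $ j)"
    by (rule sum_pos_def_psd_nonneg) (use pos psd h_sym[OF x] in auto)
  also have "\<dots> = trace (math x ** transpose K)"
    by (simp add: trace_def matrix_matrix_mult_def transpose_def)
  also have "transpose K = K"
  proof -
    have "transpose B = B" using symB by (simp add: transpose_def vec_eq_iff)
    then show ?thesis by (simp add: K_def matrix_transpose_mul transpose_math[OF x] matrix_mul_assoc)
  qed
  also have "trace (math x ** K) = trace ((math x ** B) ** (math x ** B))"
    by (simp add: K_def matrix_mul_assoc)
  also have "math x ** B = math x ** matRic x - c *\<^sub>R mat 1"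
    by (simp add: B_def matrix_mult_diff_right matrix_scalar_ac scalar_matrix_assoc[symmetric] math_matg[OF x])
  also have "trace (\<dots> ** \<dots>) = trace (math x ** matRic x ** (math x ** matRic x))
      - 2 * c * trace (math x ** matRic x) + c\<^sup>2 * real CARD('n)"
  proof -
    have tr: "trace (r *\<^sub>R M) = r * trace M" for r and M :: "real^'n^'n"
      by (simp add: trace_def sum_distrib_left)
    have "(M - c *\<^sub>R mat 1) ** (M - c *\<^sub>R mat 1) = M ** M - c *\<^sub>R M - c *\<^sub>R (M - c *\<^sub>R mat 1)"
      for M :: "real^'n^'n"
      by (simp add: matrix_mult_diff_right matrix_mult_diff_left matrix_scalar_ac
          scalar_matrix_assoc[symmetric])
    then show ?thesis
      by (simp add: trace_sub tr trace_I power2_eq_square right_diff_distrib)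
  qed
  also have "trace (math x ** matRic x) = Sc x"
    by (simp add: trace_def matrix_matrix_mult_def Sc_def) (simp add: Ric_sym[OF x])
  finally show ?thesis
    by (simp add: c_def power2_eq_square field_simps)
qed

end

section \<open>Second derivative test and inverses of positive definite matrices\<close>

lemma second_derivative_at_min:
  fixes f f' :: "real \<Rightarrow> real"
  assumes d: "d > 0"
    and f: "\<And>s. \<bar>s\<bar> < d \<Longrightarrow> (f has_real_derivative f' s) (at s)"
    and f': "(f' has_real_derivative c) (at 0)"
    and min: "\<And>s. \<bar>s\<bar> < d \<Longrightarrow> f 0 \<le> f s"
  shows "f' 0 = 0" "c \<ge> 0"
proof -
  show 0: "f' 0 = 0"
    using DERIV_local_min[OF f[of 0] d] min d by simp
  show "c \<ge> 0"
  proof (rule ccontr)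
    assume "\<not> c \<ge> 0"
    then obtain r where r: "r > 0" "\<And>s. 0 < s \<Longrightarrow> s < r \<Longrightarrow> f' s < 0"
      using DERIV_neg_dec_right[OF f'] 0 by auto
    define s where "s = min d r / 2"
    have s: "0 < s" "s < d" "s < r" using d r by (auto simp: s_def)
    obtain z where z: "0 < z" "z < s" "f s - f 0 = (s - 0) * f' z"
      using MVT2[of 0 s f f'] f s by fastforce
    then have "f s < f 0" using mult_pos_neg[of s "f' z"] r(2)[of z] s by simp
    then show False using min[of s] s by simp
  qed
qed

lemma matrix_inv_eq:
  fixes A B :: "real^'n^'n"
  assumes "B ** A = mat 1"
  shows "matrix_inv A = B"
proof -
  have "A ** B = mat 1" using assms matrix_left_right_inverse by blast
  then have "\<exists>C. A ** C = mat 1 \<and> C ** A = mat 1" using assms by blast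
  then have "A ** matrix_inv A = mat 1" unfolding matrix_inv_def by (metis (mono_tags, lifting) someI_ex)
  then have "B ** (A ** matrix_inv A) = B" by simp
  then show ?thesis by (simp add: matrix_mul_assoc assms)
qed

lemma matrix_inv_mult:
  fixes A :: "real^'n^'n"
  assumes "invertible A"
  shows "matrix_inv A ** A = mat 1" "A ** matrix_inv A = mat 1"
  using assms matrix_inv_eq unfolding invertible_def by metis+

lemma smooth_on_det:
  fixes F :: "'a::real_normed_vector \<Rightarrow> real^'n^'n"
  assumes "\<And>i j. smooth_on (\<lambda>z. F z $ i $ j) S"
  shows "smooth_on (\<lambda>z. det (F z)) S"
  unfolding det_def by (intro smooth_intros assms)

text \<open>Cramer's rule: an entry of the inverse is a quotient of two determinants, that is, of
  polynomials in the entries. \<open>N\<close> replaces column k by the l-th unit vector.\<close>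

lemma smooth_on_matrix_inv:
  fixes F :: "'a::real_normed_vector \<Rightarrow> real^'n^'n"
  assumes F: "\<And>i j. smooth_on (\<lambda>z. F z $ i $ j) S"
    and inv: "\<And>z. z \<in> S \<Longrightarrow> invertible (F z)"
  shows "smooth_on (\<lambda>z. matrix_inv (F z) $ k $ l) S"
proof -
  define N where "N z = (\<chi> i j. if j = k then axis l 1 $ i else F z $ i $ j)" for z
  have N: "smooth_on (\<lambda>z. det (N z)) S"
  proof (rule smooth_on_det)
    show "smooth_on (\<lambda>z. N z $ i $ j) S" for i j
      by (cases "j = k") (auto simp: N_def intro: smooth_intros F)
  qed
  have d: "det (F z) \<noteq> 0" if "z \<in> S" for z
    using inv[OF that] invertible_det_nz by blast
  have "smooth_on (\<lambda>z. det (N z) * inverse (det (F z))) S"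
    by (intro smooth_on_mult N smooth_on_inverse smooth_on_det F d)
  then show ?thesis
  proof (rule smooth_on_cong)
    fix z assume z: "z \<in> S"
    have "F z *v (matrix_inv (F z) *v axis l 1) = axis l 1"
      by (simp add: matrix_vector_mul_assoc matrix_inv_mult(2)[OF inv[OF z]])
    then have "matrix_inv (F z) *v axis l 1 = (\<chi> k. det (\<chi> i j. if j = k then axis l 1 $ i else F z $ i $ j) / det (F z))"
      using cramer[OF d[OF z]] by blast
    then have "(matrix_inv (F z) *v axis l 1) $ k = det (N z) / det (F z)"
      by (simp add: N_def)
    then show "det (N z) * inverse (det (F z)) = matrix_inv (F z) $ k $ l"
      by (simp add: matrix_vector_mul_component inner_axis divide_inverse matrix_vector_mult_basis column_def)
  qed
qed

lemma pos_def_invertible: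
  fixes A :: "real^'n^'n"
  assumes pos: "\<And>v. \<exists>i. v i \<noteq> 0 \<Longrightarrow> (\<Sum>i\<in>UNIV. \<Sum>j\<in>UNIV. v i * v j * A $ i $ j) > 0"
  shows "invertible A"
proof -
  have "x = 0" if "A *v x = 0" for x
  proof (rule ccontr)
    assume "x \<noteq> 0"
    then have "0 < (\<Sum>i\<in>UNIV. \<Sum>j\<in>UNIV. x $ i * x $ j * A $ i $ j)"
      by (intro pos) (auto simp: vec_eq_iff)
    also have "\<dots> = (\<Sum>i\<in>UNIV. x $ i * (A *v x) $ i)"
      by (simp add: matrix_vector_mult_def sum_distrib_left mult_ac)
    finally show False using that by simp
  qed
  then show ?thesis using matrix_left_invertible_ker invertible_left_inverse by blast
qed

text \<open>Substituting v = A w turns the form of the inverse at v into the form of A at w.\<close>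

lemma pos_def_matrix_inv:
  fixes A :: "real^'n^'n"
  assumes pos: "\<And>v. \<exists>i. v i \<noteq> 0 \<Longrightarrow> (\<Sum>i\<in>UNIV. \<Sum>j\<in>UNIV. v i * v j * A $ i $ j) > 0"
    and v: "\<exists>i. v i \<noteq> 0"
  shows "(\<Sum>i\<in>UNIV. \<Sum>j\<in>UNIV. v i * v j * matrix_inv A $ i $ j) > 0"
proof -
  note inv = matrix_inv_mult[OF pos_def_invertible[OF pos]]
  define w where "w = matrix_inv A *v (\<chi> i. v i)"
  have Aw: "A *v w = (\<chi> i. v i)"
    by (simp add: w_def matrix_vector_mul_assoc inv)
  have "w \<noteq> 0"
  proof
    assume "w = 0"
    then have "(\<chi> i. v i) = 0" using Aw by simp
    then show False using v by (simp add: vec_eq_iff)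
  qed
  then have "0 < (\<Sum>i\<in>UNIV. \<Sum>j\<in>UNIV. w $ i * w $ j * A $ i $ j)"
    by (intro pos) (auto simp: vec_eq_iff)
  also have "\<dots> = (\<Sum>i\<in>UNIV. w $ i * (A *v w) $ i)"
    by (simp add: matrix_vector_mult_def sum_distrib_left mult_ac)
  also have "\<dots> = (\<Sum>i\<in>UNIV. \<Sum>j\<in>UNIV. v i * v j * matrix_inv A $ i $ j)"
    unfolding Aw by (simp add: w_def matrix_vector_mult_def sum_distrib_left mult_ac)
  finally show ?thesis .
qed

lemma symmetric_matrix_inv:
  fixes A :: "real^'n^'n"
  assumes "invertible A" "transpose A = A"
  shows "matrix_inv A $ i $ j = matrix_inv A $ j $ i"
proof -
  have "transpose (matrix_inv A) ** A = mat 1"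
    by (metis assms matrix_inv_mult(2) matrix_transpose_mul transpose_mat)
  then have "matrix_inv A = transpose (matrix_inv A)" by (rule matrix_inv_eq)
  then show ?thesis by (metis (no_types, lifting) transpose_def vec_lambda_beta)
qed

section \<open>Differential inequality at a spatial minimum\<close>

context ricci_flow_calculus
begin

text \<open>Minimality is assumed only along the span of the \<open>e i\<close>, i.e. within a time
  slice. The one-variable test on lines through x kills the gradient, hence the Christoffel term of
  \<open>Lap\<close>, and makes the Hessian positive semidefinite; what remains is its pairing with
  the positive definite \<open>h\<close>.\<close>

lemma Lap_nonneg_at_min:
  assumes x: "x \<in> S" and f: "smooth_on f S"
    and pos: "\<And>v. \<exists>i. v i \<noteq> 0 \<Longrightarrow> (\<Sum>i\<in>UNIV. \<Sum>j\<in>UNIV. v i * v j * h i j x) > 0"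
    and min: "\<And>v. x + (\<Sum>i\<in>UNIV. v i *\<^sub>R e i) \<in> S \<Longrightarrow> f x \<le> f (x + (\<Sum>i\<in>UNIV. v i *\<^sub>R e i))"
  shows "Lap f x \<ge> 0"
proof -
  define E where "E v = (\<Sum>i\<in>UNIV. v i *\<^sub>R e i)" for v
  have dE: "dder (E v) F y = (\<Sum>i\<in>UNIV. v i * pd i F y)" if "y \<in> S" "smooth_on F S" for v y F
  proof -
    have lin: "linear (\<lambda>u. dder u F y)"
      using has_dder[OF that(2,1)] has_derivative_linear by blast
    show ?thesis by (simp add: E_def linear_sum[OF lin] linear_cmul[OF lin])
  qed
  have 2: "dder (E v) f x = 0 \<and> dder (E v) (dder (E v) f) x \<ge> 0" for v
  proof -
    obtain d where d: "d > 0" "\<And>s. \<bar>s\<bar> < d \<Longrightarrow> x + s *\<^sub>R E v \<in> S"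
    proof -
      have "open ((\<lambda>s. x + s *\<^sub>R E v) -` S)"
        by (intro open_vimage open_S continuous_intros)
      moreover have "0 \<in> (\<lambda>s. x + s *\<^sub>R E v) -` S" using x by simp
      ultimately obtain d where "d > 0" "ball 0 d \<subseteq> (\<lambda>s. x + s *\<^sub>R E v) -` S"
        using open_contains_ball by meson
      then show thesis by (intro that[of d]) (auto simp: subset_iff dist_real_def)
    qed
    have 1: "((\<lambda>s. f (x + s *\<^sub>R E v)) has_real_derivative dder (E v) f (x + s *\<^sub>R E v)) (at s)"
      if "\<bar>s\<bar> < d" for s
      using dder_line[OF f d(2)[OF that]] by (simp add: has_real_derivative_iff_has_vector_derivative)
    have 2: "((\<lambda>s. dder (E v) f (x + s *\<^sub>R E v)) has_real_derivative dder (E v) (dder (E v) f) x) (at 0)"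
      using dder_line[OF smooth_dder[OF f], of x 0 "E v" "E v"] x
      by (simp add: has_real_derivative_iff_has_vector_derivative)
    have sE: "s *\<^sub>R E v = (\<Sum>i\<in>UNIV. (s * v i) *\<^sub>R e i)" for s
      by (simp add: E_def scaleR_sum_right)
    have 3: "f (x + 0 *\<^sub>R E v) \<le> f (x + s *\<^sub>R E v)" if "\<bar>s\<bar> < d" for s
      using min[of "\<lambda>i. s * v i"] d(2)[OF that] by (simp add: sE)
    show ?thesis using second_derivative_at_min[OF d(1) 1 2 3] by simp
  qed
  have grad: "pd m f x = 0" for m
    using 2[of "\<lambda>i. if i = m then 1 else 0"] dE[OF x f]
    by (simp add: if_distrib[of "\<lambda>z. z * _"] cong: if_cong)
  have hess: "(\<Sum>i\<in>UNIV. \<Sum>j\<in>UNIV. v i * v j * pd i (pd j f) x) \<ge> 0" for v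
  proof -
    have "dder (E v) (dder (E v) f) x = dder (E v) (\<lambda>y. \<Sum>j\<in>UNIV. v j * pd j f y) x"
      by (intro dder_cong[OF open_S x] dE f smooth_intros)
    also have "\<dots> = (\<Sum>i\<in>UNIV. v i * pd i (\<lambda>y. \<Sum>j\<in>UNIV. v j * pd j f y) x)"
      by (intro dE x smooth_intros f)
    also have "\<dots> = (\<Sum>i\<in>UNIV. \<Sum>j\<in>UNIV. v i * v j * pd i (pd j f) x)"
      by (simp add: dder_sum dder_cmult x smooth_intros f sum_distrib_left mult.assoc)
    finally show ?thesis using 2[of v] by simp
  qed
  have "0 \<le> (\<Sum>j\<in>UNIV. \<Sum>k\<in>UNIV. h j k x * pd j (pd k f) x)"
    by (rule sum_pos_def_psd_nonneg) (use pos hess h_sym[OF x] in auto)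
  then show ?thesis by (simp add: Lap_def grad)
qed

lemma Sc_evolution_at_min:
  assumes x: "x \<in> S"
    and pos: "\<And>v. \<exists>i. v i \<noteq> 0 \<Longrightarrow> (\<Sum>i\<in>UNIV. \<Sum>j\<in>UNIV. v i * v j * h i j x) > 0"
    and min: "\<And>v. x + (\<Sum>i\<in>UNIV. v i *\<^sub>R e i) \<in> S \<Longrightarrow> Sc x \<le> Sc (x + (\<Sum>i\<in>UNIV. v i *\<^sub>R e i))"
  shows "dder \<tau> Sc x \<ge> 2 / real CARD('n) * (Sc x)\<^sup>2"
proof -
  have "(Sc x)\<^sup>2 / real CARD('n) \<le> trace (math x ** matRic x ** (math x ** matRic x))"
    using norm_Ric_ge[OF x pos] by (simp add: field_simps)
  then show ?thesis
    using Lap_nonneg_at_min[OF x smooth_Sc pos min] scalar_curvature_evolution[OF x] by simp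
qed

end

subsection \<open>Charts and tangent vectors\<close>

locale smooth_manifold =
  fixes M :: "'m topology" and A :: "('m, 'n::finite) chart set"
  assumes atlas: "smooth_atlas M A"
begin

abbreviation dom :: "('m, 'n) chart \<Rightarrow> (real^'n) set" where "dom c \<equiv> snd c ` fst c"

lemma chart:
  assumes "c \<in> A"
  shows "openin M (fst c)" "open (dom c)" "fst c \<subseteq> topspace M" "inj_on (snd c) (fst c)"
    "continuous_map (subtopology M (fst c)) (top_of_set (dom c)) (snd c)"
proof -
  have c: "openin M (fst c)" "open (dom c)"
    "homeomorphic_map (subtopology M (fst c)) (top_of_set (dom c)) (snd c)"
    using assms atlas unfolding smooth_atlas_def chart_on_def by blast+
  show "openin M (fst c)" "open (dom c)" by fact+
  show "fst c \<subseteq> topspace M" using c openin_subset by blast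
  then have "topspace (subtopology M (fst c)) = fst c" by auto
  then show "inj_on (snd c) (fst c)"
    using homeomorphic_imp_injective_map[OF c(3)] by simp
  show "continuous_map (subtopology M (fst c)) (top_of_set (dom c)) (snd c)"
    using homeomorphic_imp_continuous_map[OF c(3)] .
qed

lemma chart_inv_chart [simp]: "c \<in> A \<Longrightarrow> p \<in> fst c \<Longrightarrow> chart_inv c (snd c p) = p"
  by (simp add: chart_inv_def chart(4))

lemma charts_cover: "p \<in> topspace M \<Longrightarrow> \<exists>c\<in>A. p \<in> fst c"
  using atlas unfolding smooth_atlas_def by blast

lemma open_overlap:
  assumes "c \<in> A" "d \<in> A"
  shows "open (snd c ` (fst c \<inter> fst d))"
proof -
  have "homeomorphic_map (subtopology M (fst c)) (top_of_set (dom c)) (snd c)"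
    using assms atlas unfolding smooth_atlas_def chart_on_def by blast
  moreover have "openin (subtopology M (fst c)) (fst c \<inter> fst d)"
    using chart(1)[OF assms(2)] by (simp add: openin_subtopology_Int2)
  ultimately have "openin (top_of_set (dom c)) (snd c ` (fst c \<inter> fst d))"
    using homeomorphic_imp_open_map unfolding open_map_def by blast
  then show ?thesis using openin_open_trans chart(2)[OF assms(1)] by blast
qed

lemma has_derivative_transition:
  assumes "c \<in> A" "d \<in> A" "p \<in> fst c" "p \<in> fst d"
  shows "(transition c d has_derivative frechet_derivative (transition c d) (at (snd c p))) (at (snd c p))"
proof -
  have "smooth_on (transition c d) (snd c ` (fst c \<inter> fst d))"
    using assms atlas unfolding smooth_atlas_def by blast
  from smooth_on_has_derivative[OF this open_overlap] assms show ?thesis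
    by (auto simp: dder_def)
qed

lemma transition_chart [simp]: "c \<in> A \<Longrightarrow> p \<in> fst c \<Longrightarrow> transition c d (snd c p) = snd d p"
  by (simp add: transition_def)

lemma transition_chain:
  assumes "c \<in> A" "d \<in> A" "k \<in> A" "p \<in> fst c" "p \<in> fst d" "p \<in> fst k"
  shows "frechet_derivative (transition c k) (at (snd c p))
    = frechet_derivative (transition d k) (at (snd d p)) \<circ> frechet_derivative (transition c d) (at (snd c p))"
proof -
  have "((\<lambda>x. transition d k (transition c d x)) has_derivative
      (\<lambda>v. frechet_derivative (transition d k) (at (snd d p)) (frechet_derivative (transition c d) (at (snd c p)) v)))
      (at (snd c p))"
    by (rule has_derivative_compose[where f = "transition c d" and g = "transition d k"])
      (use assms has_derivative_transition in auto)
  then have "(transition c k has_derivative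
      (\<lambda>v. frechet_derivative (transition d k) (at (snd d p)) (frechet_derivative (transition c d) (at (snd c p)) v)))
      (at (snd c p))"
  proof (rule has_derivative_transform_within_open[OF _ open_overlap[OF assms(1,2)]])
    show "snd c p \<in> snd c ` (fst c \<inter> fst d)" using assms by blast
    fix x assume "x \<in> snd c ` (fst c \<inter> fst d)"
    then obtain q where "x = snd c q" "q \<in> fst c" "q \<in> fst d" by blast
    then show "transition d k (transition c d x) = transition c k x" by (simp add: assms(1,2))
  qed
  from frechet_derivative_at[OF this] show ?thesis by (simp add: o_def)
qed

lemma transition_self:
  assumes "c \<in> A" "p \<in> fst c"
  shows "frechet_derivative (transition c c) (at (snd c p)) = (\<lambda>v. v)"
proof -
  have "((\<lambda>x. x) has_derivative (\<lambda>v. v)) (at (snd c p))" by (rule has_derivative_ident)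
  then have "(transition c c has_derivative (\<lambda>v. v)) (at (snd c p))"
  proof (rule has_derivative_transform_within_open[OF _ chart(2)[OF assms(1)]])
    show "snd c p \<in> dom c" using assms by blast
    show "x = transition c c x" if "x \<in> dom c" for x
      using that by (metis (no_types, lifting) assms(1) image_iff transition_chart)
  qed
  from frechet_derivative_at[OF this] show ?thesis by simp
qed

lemma linear_transition:
  assumes "c \<in> A" "d \<in> A" "p \<in> fst c" "p \<in> fst d"
  shows "linear (frechet_derivative (transition c d) (at (snd c p)))"
  using has_derivative_transition[OF assms] has_derivative_linear by blast

lemma coord_vector_tangent:
  assumes "c \<in> A" "p \<in> fst c"
  shows "coord_vector A c i p \<in> tangent_space A p"
  unfolding tangent_space_def
proof (intro CollectI conjI allI ballI impI)
  fix d k assume d: "d \<in> A" "k \<in> A" "p \<in> fst d \<inter> fst k"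
  then show "coord_vector A c i p k
      = frechet_derivative (transition d k) (at (snd d p)) (coord_vector A c i p d)"
    using transition_chain[OF assms(1) d(1,2) assms(2)] by (simp add: coord_vector_def)
qed (auto simp: coord_vector_def)

lemma tangent_spaceD:
  assumes "X \<in> tangent_space A p" "c \<in> A" "d \<in> A" "p \<in> fst c" "p \<in> fst d"
  shows "X d = frechet_derivative (transition c d) (at (snd c p)) (X c)"
  using assms unfolding tangent_space_def by blast

lemma tangent_space_outside: "X \<in> tangent_space A p \<Longrightarrow> \<not> (c \<in> A \<and> p \<in> fst c) \<Longrightarrow> X c = 0"
  unfolding tangent_space_def by blast

lemma zero_tangent: "(\<lambda>c. 0) \<in> tangent_space A p"
  unfolding tangent_space_def using linear_0[OF linear_transition] by simp

lemma tangent_add: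
  assumes "X \<in> tangent_space A p" "Y \<in> tangent_space A p"
  shows "(\<lambda>c. a *\<^sub>R X c + Y c) \<in> tangent_space A p"
  unfolding tangent_space_def
proof (intro CollectI conjI allI ballI impI)
  fix c d assume c: "c \<in> A" "d \<in> A" "p \<in> fst c \<inter> fst d"
  then have "X d = frechet_derivative (transition c d) (at (snd c p)) (X c)"
    "Y d = frechet_derivative (transition c d) (at (snd c p)) (Y c)"
    using tangent_spaceD[OF assms(1), of c d] tangent_spaceD[OF assms(2), of c d] by auto
  then show "a *\<^sub>R X d + Y d = frechet_derivative (transition c d) (at (snd c p)) (a *\<^sub>R X c + Y c)"
    using linear_transition[of c d p] c by (simp add: linear_add linear_cmul)
qed (simp add: tangent_space_outside[OF assms(1)] tangent_space_outside[OF assms(2)])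

lemma tangent_sum:
  assumes "\<And>k. k \<in> F \<Longrightarrow> X k \<in> tangent_space A p"
  shows "(\<lambda>c. \<Sum>k\<in>F. a k *\<^sub>R X k c) \<in> tangent_space A p"
  using assms
proof (induction F rule: infinite_finite_induct)
  case (insert k F)
  then show ?case using tangent_add[of "X k" p "\<lambda>c. \<Sum>k\<in>F. a k *\<^sub>R X k c" "a k"] by simp
qed (auto intro: zero_tangent)

lemma inner_product_sum_left:
  assumes B: "inner_product_on_tangent A p B" and Z: "Z \<in> tangent_space A p"
    and X: "\<And>k. k \<in> F \<Longrightarrow> X k \<in> tangent_space A p"
  shows "B (\<lambda>c. \<Sum>k\<in>F. a k *\<^sub>R X k c) Z = (\<Sum>k\<in>F. a k * B (X k) Z)"
proof -
  have lin: "B (\<lambda>c. r *\<^sub>R X c + Y c) Z = r * B X Z + B Y Z"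
    if "X \<in> tangent_space A p" "Y \<in> tangent_space A p" for r X Y
    using B Z that unfolding inner_product_on_tangent_def by blast
  \<comment> \<open>With both arguments zero and scalar 1, linearity reads B 0 Z = B 0 Z + B 0
    Z.\<close>
  have zero: "B (\<lambda>c. 0) Z = 0"
    using lin[OF zero_tangent zero_tangent, of 1] by simp
  show ?thesis
    using X
  proof (induction F rule: infinite_finite_induct)
    case (insert k F)
    then show ?case
      using lin[of "X k" "\<lambda>c. \<Sum>k\<in>F. a k *\<^sub>R X k c" "a k"] tangent_sum[of F X p a] by simp
  qed (auto simp: zero)
qed

lemma inner_product_sum_sum:
  assumes B: "inner_product_on_tangent A p B"
    and X: "\<And>k. k \<in> F \<Longrightarrow> X k \<in> tangent_space A p" and Y: "\<And>k. k \<in> G \<Longrightarrow> Y k \<in> tangent_space A p"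
  shows "B (\<lambda>c. \<Sum>k\<in>F. a k *\<^sub>R X k c) (\<lambda>c. \<Sum>l\<in>G. b l *\<^sub>R Y l c)
    = (\<Sum>k\<in>F. \<Sum>l\<in>G. a k * b l * B (X k) (Y l))"
proof -
  let ?Y = "\<lambda>c. \<Sum>l\<in>G. b l *\<^sub>R Y l c"
  have sym: "B X Z = B Z X" if "X \<in> tangent_space A p" "Z \<in> tangent_space A p" for X Z
    using B that unfolding inner_product_on_tangent_def by blast
  have Y': "?Y \<in> tangent_space A p" using tangent_sum Y by blast
  have "B (X k) ?Y = (\<Sum>l\<in>G. b l * B (X k) (Y l))" if "k \<in> F" for k
    using inner_product_sum_left[OF B X[OF that], of G Y b] Y Y' X[OF that] sym by simp
  then show ?thesis
    using inner_product_sum_left[OF B Y', of F X a] X by (simp add: sum_distrib_left mult.assoc)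
qed

lemma metric_matrix_chart:
  "c \<in> A \<Longrightarrow> p \<in> fst c \<Longrightarrow>
    metric_matrix A b c (snd c p) $ i $ j = b p (coord_vector A c i p) (coord_vector A c j p)"
  by (simp add: metric_matrix_def)

definition jac :: "('m, 'n) chart \<Rightarrow> ('m, 'n) chart \<Rightarrow> 'm \<Rightarrow> real^'n^'n" where
  "jac c d p = matrix (frechet_derivative (transition c d) (at (snd c p)))"

lemma jac_mult:
  assumes "c \<in> A" "d \<in> A" "p \<in> fst c" "p \<in> fst d"
  shows "jac d c p ** jac c d p = mat 1"
proof -
  have "jac d c p ** jac c d p = matrix (frechet_derivative (transition d c) (at (snd d p))
      \<circ> frechet_derivative (transition c d) (at (snd c p)))"
    unfolding jac_def by (rule matrix_compose[symmetric]) (use assms linear_transition in auto)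
  also have "\<dots> = matrix (\<lambda>v. v)"
    using transition_chain[of c d c p] transition_self assms by metis
  finally show ?thesis by (simp add: matrix_def mat_def axis_def vec_eq_iff)
qed

lemma coord_vector_change:
  assumes "c \<in> A" "d \<in> A" "p \<in> fst c" "p \<in> fst d"
  shows "coord_vector A c i p = (\<lambda>k. \<Sum>a\<in>UNIV. jac c d p $ a $ i *\<^sub>R coord_vector A d a p k)"
proof
  fix k
  show "coord_vector A c i p k = (\<Sum>a\<in>UNIV. jac c d p $ a $ i *\<^sub>R coord_vector A d a p k)"
  proof (cases "k \<in> A \<and> p \<in> fst k")
    case True
    let ?D = "frechet_derivative (transition d k) (at (snd d p))"
    let ?v = "frechet_derivative (transition c d) (at (snd c p)) (axis i 1)"
    have lin: "linear ?D" using True assms linear_transition by auto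
    have "coord_vector A c i p k = ?D ?v"
      using True assms transition_chain[of c d k p] by (simp add: coord_vector_def)
    also have "?v = (\<Sum>a\<in>UNIV. ?v $ a *\<^sub>R axis a 1)"
      using basis_expansion[of ?v] by (simp add: scalar_mult_eq_scaleR)
    also have "?D \<dots> = (\<Sum>a\<in>UNIV. ?v $ a *\<^sub>R ?D (axis a 1))"
      by (simp add: linear_sum[OF lin] linear_cmul[OF lin])
    finally show ?thesis using True by (simp add: coord_vector_def jac_def matrix_def)
  qed (auto simp: coord_vector_def)
qed

lemma metric_matrix_change:
  assumes "c \<in> A" "d \<in> A" "p \<in> fst c" "p \<in> fst d" "inner_product_on_tangent A p (b p)"
  shows "metric_matrix A b c (snd c p)
    = transpose (jac c d p) ** metric_matrix A b d (snd d p) ** jac c d p"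
proof -
  have "metric_matrix A b c (snd c p) $ i $ j
      = (\<Sum>k\<in>UNIV. \<Sum>l\<in>UNIV. jac c d p $ k $ i * jac c d p $ l $ j * metric_matrix A b d (snd d p) $ k $ l)" for i j
    using inner_product_sum_sum[OF assms(5), of UNIV "\<lambda>k. coord_vector A d k p" UNIV "\<lambda>k. coord_vector A d k p"]
      coord_vector_tangent[OF assms(2,4)] assms
    by (simp add: metric_matrix_chart coord_vector_change[OF assms(1-4)])
  also have "\<dots> i j = (\<Sum>l\<in>UNIV. \<Sum>k\<in>UNIV. jac c d p $ k $ i * jac c d p $ l $ j * metric_matrix A b d (snd d p) $ k $ l)" for i j
    by (rule sum.swap)
  finally show ?thesis
    by (simp add: vec_eq_iff matrix_matrix_mult_def transpose_def sum_distrib_left sum_distrib_right mult_ac)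
qed

lemma metric_matrix_pos:
  assumes c: "c \<in> A" "p \<in> fst c" and B: "inner_product_on_tangent A p (b p)" and v: "\<exists>i. v i \<noteq> 0"
  shows "(\<Sum>i\<in>UNIV. \<Sum>j\<in>UNIV. v i * v j * metric_matrix A b c (snd c p) $ i $ j) > 0"
proof -
  let ?V = "\<lambda>k. \<Sum>i\<in>UNIV. v i *\<^sub>R coord_vector A c i p k"
  \<comment> \<open>In its own chart the transition map is the identity, so the coordinate vectors
    have unit vectors as components; this shows that the combination is nonzero.\<close>
  have "?V c $ i = v i" for i
    using c transition_self[OF c]
    by (simp add: coord_vector_def axis_def if_distrib[of "\<lambda>z. _ * z"] cong: if_cong)
  then have "?V \<noteq> (\<lambda>c. 0)" using v by (metis zero_index)
  moreover have "?V \<in> tangent_space A p"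
    by (intro tangent_sum coord_vector_tangent c)
  ultimately have "b p ?V ?V > 0" using B unfolding inner_product_on_tangent_def by blast
  then show ?thesis
    using inner_product_sum_sum[OF B, of UNIV "\<lambda>k. coord_vector A c k p" UNIV "\<lambda>k. coord_vector A c k p" v v]
      coord_vector_tangent[OF c] c
    by (simp add: metric_matrix_chart)
qed

lemma metric_matrix_sym:
  assumes c: "c \<in> A" "p \<in> fst c" and B: "inner_product_on_tangent A p (b p)"
  shows "transpose (metric_matrix A b c (snd c p)) = metric_matrix A b c (snd c p)"
  using B coord_vector_tangent[OF c] c unfolding inner_product_on_tangent_def
  by (simp add: vec_eq_iff transpose_def metric_matrix_chart)

end

subsection \<open>Ricci flow in a chart\<close>

context
  fixes U :: "(real^'n) set" and I :: "real set" and f :: "(real^'n) \<times> real \<Rightarrow> real" and x t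
  assumes U: "open U" "open I" and x: "x \<in> U" "t \<in> I" and f: "smooth_on f (U \<times> I)"
begin

lemma has_derivative_slice: "(f has_derivative (\<lambda>v. dder v f (x, t))) (at (x, t))"
  by (rule smooth_on_has_derivative[OF f]) (use U x in \<open>auto intro: open_Times\<close>)

text \<open>Bridge between \<open>partial\<close>, taken in a fixed time slice, and
  \<open>dder\<close> on space-time. Agreement of F with f is required on the chart domain only,
  because the values of coordinate expressions outside it are meaningless.\<close>

lemma partial_slice:
  assumes "\<And>y. y \<in> U \<Longrightarrow> F y = f (y, t)"
  shows "partial i F x = dder (axis i 1, 0) f (x, t)"
proof -
  have "((\<lambda>y. f (y, t)) has_derivative (\<lambda>v. dder (v, 0) f (x, t))) (at x)"
    by (rule has_derivative_compose[where f = "\<lambda>y. (y, t)" and g = f])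
      (auto intro!: derivative_eq_intros has_derivative_slice)
  then have "(F has_derivative (\<lambda>v. dder (v, 0) f (x, t))) (at x)"
    by (rule has_derivative_transform_within_open[OF _ U(1) x(1)]) (simp add: assms)
  from frechet_derivative_at[OF this, symmetric] show ?thesis by (simp add: partial_def)
qed

lemma time_slice:
  assumes "\<And>s. s \<in> I \<Longrightarrow> F s = f (x, s)"
  shows "(F has_real_derivative dder (0, 1) f (x, t)) (at t)"
proof -
  have "((\<lambda>s. f (x, s)) has_derivative (\<lambda>v. dder (0, v) f (x, t))) (at t)"
    by (rule has_derivative_compose[where f = "\<lambda>s. (x, s)" and g = f])
      (auto intro!: derivative_eq_intros has_derivative_slice)
  moreover have "(\<lambda>v. dder (0, v) f (x, t)) = (*) (dder (0, 1) f (x, t))"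
  proof
    show "dder (0, v) f (x, t) = dder (0, 1) f (x, t) * v" for v
      using linear_cmul[OF has_derivative_linear[OF has_derivative_slice], of v "(0, 1)"]
      by (simp add: mult.commute)
  qed
  ultimately have "((\<lambda>s. f (x, s)) has_real_derivative dder (0, 1) f (x, t)) (at t)"
    unfolding has_field_derivative_def by (simp only:)
  then show ?thesis
    by (rule has_field_derivative_transform_within_open) (use assms U x in auto)
qed

end

section \<open>Independence of the scalar curvature from the chart\<close>

locale manifold_ricci_flow = smooth_manifold M A
  for M :: "'m topology" and A :: "('m, 'n::finite) chart set" +
  fixes g :: "real \<Rightarrow> ('m, 'n) metric" and T :: real
  assumes ricci_flow: "ricci_flow M A T g"
begin

lemma inner_product: "p \<in> topspace M \<Longrightarrow> t \<in> {0..T} \<Longrightarrow> inner_product_on_tangent A p (g t p)"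
  using ricci_flow unfolding ricci_flow_def riemannian_metric_def by blast

lemma ricci_flow_eq:
  assumes "c \<in> A" "x \<in> dom c" "t \<in> {0<..<T}"
  shows "((\<lambda>s. metric_matrix A (g s) c x $ i $ j) has_real_derivative
    - 2 * ricci (metric_matrix A (g t) c) i j x) (at t)"
proof -
  have "((\<lambda>s. metric_matrix A (g s) c x $ i $ j) has_real_derivative
      - 2 * ricci (metric_matrix A (g t) c) i j x) (at t within {0..T})"
    using ricci_flow assms unfolding ricci_flow_def by auto
  then show ?thesis using assms(3) by (simp add: at_within_Icc_at)
qed

lemma scalar_curvature_coord_change:
  assumes cd: "c \<in> A" "d \<in> A" "p \<in> fst c" "p \<in> fst d" and t: "t \<in> {0<..<T}"
  shows "scalar_curvature_coord (metric_matrix A (g t) c) (snd c p)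
    = scalar_curvature_coord (metric_matrix A (g t) d) (snd d p)"
proof -
  define G where "G k s = metric_matrix A (g s) k (snd k p)" for k s
  define R where "R k = (\<chi> i j. ricci (metric_matrix A (g t) k) i j (snd k p))" for k
  define J where "J = jac c d p"
  define K where "K = jac d c p"
  have KJ: "K ** J = mat 1" "J ** K = mat 1"
    using jac_mult cd by (simp_all add: J_def K_def)
  have p: "p \<in> topspace M" using cd chart(3) by blast
  \<comment> \<open>The Jacobian depends on p but not on time, so one and the same \<open>J\<close>
    serves all times near t and the relation may be differentiated in time.\<close>
  have change: "G c s = transpose J ** G d s ** J" if "s \<in> {0<..<T}" for s
    unfolding G_def J_def using that by (intro metric_matrix_change cd inner_product[OF p]) auto
  have flow: "((\<lambda>s. G k s $ i $ j) has_real_derivative - 2 * R k $ i $ j) (at t)"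
    if "k \<in> {c, d}" for k i j
    using ricci_flow_eq[of k "snd k p" t] that cd t by (auto simp: G_def R_def)
  \<comment> \<open>the Ricci tensor is - 1/2 times the time derivative of the metric, which transforms like the metric\<close>
  have R: "R c = transpose J ** R d ** J"
  proof -
    have "((\<lambda>s. (transpose J ** G d s ** J) $ i $ j) has_real_derivative
        - 2 * (transpose J ** R d ** J) $ i $ j) (at t)" for i j
      by (auto simp: matrix_matrix_mult_def sum_distrib_left sum_distrib_right mult_ac
          intro!: derivative_eq_intros flow sum.cong)
    then have "((\<lambda>s. G c s $ i $ j) has_real_derivative
        - 2 * (transpose J ** R d ** J) $ i $ j) (at t)" for i j
      by (rule has_field_derivative_transform_within_open[OF _ open_greaterThanLessThan t])
        (simp add: change)
    then have "- 2 * R c $ i $ j = - 2 * (transpose J ** R d ** J) $ i $ j" for i j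
      using DERIV_unique flow[of c] by blast
    then show ?thesis by (simp add: vec_eq_iff)
  qed
  have inv: "invertible (G d t)"
    unfolding G_def
    by (rule pos_def_invertible) (use metric_matrix_pos cd inner_product[OF p] t in auto)
  have H: "matrix_inv (G c t) = K ** matrix_inv (G d t) ** transpose K"
  proof (rule matrix_inv_eq)
    have "transpose K ** transpose J = mat 1"
      by (metis KJ(2) matrix_transpose_mul transpose_mat)
    then have "K ** matrix_inv (G d t) ** transpose K ** (transpose J ** G d t ** J)
        = K ** (matrix_inv (G d t) ** G d t) ** J"
      by (metis matrix_mul_assoc matrix_mul_lid)
    then show "K ** matrix_inv (G d t) ** transpose K ** G c t = mat 1"
      by (simp add: change[OF t] matrix_inv_mult[OF inv] KJ)
  qed
  have scal: "scalar_curvature_coord (metric_matrix A (g t) k) (snd k p)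
      = trace (matrix_inv (G k t) ** transpose (R k))" for k
    by (simp add: scalar_curvature_coord_def trace_def matrix_matrix_mult_def transpose_def G_def R_def)
  have "transpose (R c) = transpose J ** transpose (R d) ** J"
    by (simp add: R matrix_transpose_mul matrix_mul_assoc)
  moreover have "transpose K ** transpose J = mat 1"
    by (metis KJ(2) matrix_transpose_mul transpose_mat)
  ultimately have "matrix_inv (G c t) ** transpose (R c) = K ** (matrix_inv (G d t) ** transpose (R d) ** J)"
    unfolding H by (metis matrix_mul_assoc matrix_mul_lid)
  then have "trace (matrix_inv (G c t) ** transpose (R c)) = trace ((matrix_inv (G d t) ** transpose (R d) ** J) ** K)"
    by (simp add: trace_mul_sym[of K])
  also have "(matrix_inv (G d t) ** transpose (R d) ** J) ** K = matrix_inv (G d t) ** transpose (R d)"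
    by (simp add: matrix_mul_assoc[symmetric] KJ)
  finally show ?thesis by (simp add: scal)
qed

lemma scalar_curvature_chart:
  assumes "c \<in> A" "p \<in> fst c" "t \<in> {0<..<T}"
  shows "scalar_curvature A (g t) p = scalar_curvature_coord (metric_matrix A (g t) c) (snd c p)"
proof -
  have "(SOME c. c \<in> A \<and> p \<in> fst c) \<in> A \<and> p \<in> fst (SOME c. c \<in> A \<and> p \<in> fst c)"
    using assms by (metis (mono_tags, lifting) someI_ex)
  then show ?thesis
    unfolding scalar_curvature_def Let_def using scalar_curvature_coord_change assms by blast
qed

end

section \<open>Identification of the coordinate definitions with the space-time calculus\<close>

locale flow_chart = manifold_ricci_flow M A g T
  for M :: "'m topology" and A :: "('m, 'n::finite) chart set"
    and g :: "real \<Rightarrow> ('m, 'n) metric" and T :: real +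
  fixes c :: "('m, 'n) chart"
  assumes chart_in_atlas: "c \<in> A"
begin

abbreviation I :: "real set" where "I \<equiv> {0<..<T}"
abbreviation U :: "(real^'n) set" where "U \<equiv> dom c"
abbreviation mm :: "real \<Rightarrow> real^'n \<Rightarrow> real^'n^'n" where "mm t \<equiv> metric_matrix A (g t) c"

lemma mm_pos:
  assumes "x \<in> U" "t \<in> {0..T}" "\<exists>i. v i \<noteq> 0"
  shows "(\<Sum>i\<in>UNIV. \<Sum>j\<in>UNIV. v i * v j * mm t x $ i $ j) > 0"
proof -
  obtain p where p: "x = snd c p" "p \<in> fst c" using assms(1) by blast
  then have "p \<in> topspace M" using chart(3)[OF chart_in_atlas] by blast
  then show ?thesis
    unfolding p(1) using metric_matrix_pos chart_in_atlas p(2) inner_product assms(2,3) by blast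
qed

lemma mm_sym:
  assumes "x \<in> U" "t \<in> {0..T}"
  shows "transpose (mm t x) = mm t x"
proof -
  obtain p where p: "x = snd c p" "p \<in> fst c" using assms(1) by blast
  then have "p \<in> topspace M" using chart(3)[OF chart_in_atlas] by blast
  then show ?thesis
    unfolding p(1) using metric_matrix_sym chart_in_atlas p(2) inner_product assms(2) by blast
qed

lemma mm_invertible: "x \<in> U \<Longrightarrow> t \<in> {0..T} \<Longrightarrow> invertible (mm t x)"
  using pos_def_invertible mm_pos by blast

lemma smooth_mm: "smooth_on (\<lambda>z. mm (snd z) (fst z) $ i $ j) (U \<times> I)"
proof -
  have "smooth_on (\<lambda>(x, t). mm t x) (U \<times> {0..T})"
    using ricci_flow chart_in_atlas unfolding ricci_flow_def by blast
  then have "smooth_on (\<lambda>(x, t). mm t x) (U \<times> I)"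
    by (rule smooth_on_subset) auto
  moreover have "bounded_linear (\<lambda>B::real^'n^'n. B $ i $ j)"
    by (intro bounded_linear_compose[OF bounded_linear_vec_nth bounded_linear_vec_nth])
  ultimately have "smooth_on (\<lambda>z. (case z of (x, t) \<Rightarrow> mm t x) $ i $ j) (U \<times> I)"
    by (intro smooth_on_linear[where L = "\<lambda>B::real^'n^'n. B $ i $ j"])
  then show ?thesis by (simp add: case_prod_beta)
qed

sublocale cal: metric_calculus "U \<times> I" "\<lambda>i. (axis i 1, 0)"
  "\<lambda>i j z. mm (snd z) (fst z) $ i $ j" "\<lambda>i j z. matrix_inv (mm (snd z) (fst z)) $ i $ j"
proof
  show "open (U \<times> I)" using chart(2)[OF chart_in_atlas] by (simp add: open_Times)
  show "smooth_on (\<lambda>z. mm (snd z) (fst z) $ i $ j) (U \<times> I)" for i j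
    by (rule smooth_mm)
  show "smooth_on (\<lambda>z. matrix_inv (mm (snd z) (fst z)) $ i $ j) (U \<times> I)" for i j
    by (rule smooth_on_matrix_inv[OF smooth_mm]) (auto intro!: mm_invertible)
next
  fix x :: "(real^'n) \<times> real" and i j assume "x \<in> U \<times> I"
  then have x: "fst x \<in> U" "snd x \<in> {0..T}" by auto
  show "mm (snd x) (fst x) $ i $ j = mm (snd x) (fst x) $ j $ i"
    using mm_sym[OF x] by (metis (no_types, lifting) transpose_def vec_lambda_beta)
  show "matrix_inv (mm (snd x) (fst x)) $ i $ j = matrix_inv (mm (snd x) (fst x)) $ j $ i"
    by (rule symmetric_matrix_inv[OF mm_invertible[OF x] mm_sym[OF x]])
  show "(\<Sum>k\<in>UNIV. matrix_inv (mm (snd x) (fst x)) $ i $ k * mm (snd x) (fst x) $ k $ j)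
      = (if i = j then 1 else 0)"
    using matrix_inv_mult(1)[OF mm_invertible[OF x]]
    by (simp add: vec_eq_iff matrix_matrix_mult_def mat_def)
qed

lemma open_U: "open U" and open_I: "open I"
  using chart(2)[OF chart_in_atlas] by auto

lemma partial_chart:
  assumes "smooth_on f (U \<times> I)" "x \<in> U" "t \<in> I" "\<And>y. y \<in> U \<Longrightarrow> F y = f (y, t)"
  shows "partial i F x = cal.pd i f (x, t)"
  by (rule partial_slice[OF open_U open_I assms(2,3,1,4)])

context
  fixes t assumes t: "t \<in> I"
begin

lemma christoffel_chart:
  assumes x: "x \<in> U"
  shows "christoffel (mm t) k i j x = cal.Gam k i j (x, t)"
proof -
  have "partial a (\<lambda>y. mm t y $ i $ j) x = cal.pd a (\<lambda>z. mm (snd z) (fst z) $ i $ j) (x, t)" for a i j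
    by (rule partial_chart[OF smooth_mm x t]) simp
  then show ?thesis by (simp add: christoffel_def cal.Gam_def)
qed

lemma riemann_chart:
  assumes x: "x \<in> U"
  shows "riemann (mm t) l i j k x = cal.Rm l i j k (x, t)"
proof -
  have "partial a (christoffel (mm t) l j k) x = cal.pd a (cal.Gam l j k) (x, t)" for a l j k
    by (rule partial_chart[OF cal.smooth_Gam x t]) (rule christoffel_chart)
  then show ?thesis by (simp add: riemann_def cal.Rm_def christoffel_chart[OF x])
qed

lemma ricci_chart: "x \<in> U \<Longrightarrow> ricci (mm t) i j x = cal.Ric i j (x, t)"
  by (simp add: ricci_def cal.Ric_def riemann_chart)

lemma scalar_curvature_coord_chart: "x \<in> U \<Longrightarrow> scalar_curvature_coord (mm t) x = cal.Sc (x, t)"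
  by (simp add: scalar_curvature_coord_def cal.Sc_def ricci_chart)

lemma scalar_curvature_Sc: "p \<in> fst c \<Longrightarrow> scalar_curvature A (g t) p = cal.Sc (snd c p, t)"
  using scalar_curvature_chart[OF chart_in_atlas] scalar_curvature_coord_chart t by simp

end

text \<open>A second interpretation is needed because the flow equation speaks of
  \<open>ricci\<close> of a time slice. Only after the first one has provided
  \<open>cal.Ric\<close>, and \<open>ricci_chart\<close> has identified the two, can the equation be
  stated in the calculus.\<close>

sublocale cal: ricci_flow_calculus "U \<times> I" "\<lambda>i. (axis i 1, 0)"
  "\<lambda>i j z. mm (snd z) (fst z) $ i $ j" "\<lambda>i j z. matrix_inv (mm (snd z) (fst z)) $ i $ j" "(0, 1)"
proof
  fix z :: "(real^'n) \<times> real" and i j assume "z \<in> U \<times> I"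
  then obtain x t where z: "z = (x, t)" "x \<in> U" "t \<in> I" by blast
  have "((\<lambda>s. mm s x $ i $ j) has_real_derivative dder (0, 1) (\<lambda>z. mm (snd z) (fst z) $ i $ j) (x, t)) (at t)"
    by (rule time_slice[OF open_U open_I z(2,3) smooth_mm]) simp
  moreover have "((\<lambda>s. mm s x $ i $ j) has_real_derivative - 2 * ricci (mm t) i j x) (at t)"
    using ricci_flow_eq[OF chart_in_atlas z(2,3)] .
  ultimately show "dder (0, 1) (\<lambda>z. mm (snd z) (fst z) $ i $ j) z = - 2 * cal.Ric i j z"
    unfolding z(1) ricci_chart[OF z(3,2), symmetric] by (rule DERIV_unique)
qed

end

section \<open>Scalar curvature as a function on space-time\<close>

context manifold_ricci_flow
begin

text \<open>The point q is kept fixed while time varies, so the function t \<mapsto> min R(., t),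
  which need not be differentiable, is never differentiated.\<close>

lemma scalar_curvature_evolution_at_min:
  assumes q: "q \<in> topspace M" and t: "t \<in> {0<..<T}"
    and min: "\<And>p. p \<in> topspace M \<Longrightarrow> scalar_curvature A (g t) q \<le> scalar_curvature A (g t) p"
  obtains D where "((\<lambda>s. scalar_curvature A (g s) q) has_real_derivative D) (at t)"
    "D \<ge> 2 / real CARD('n) * (scalar_curvature A (g t) q)\<^sup>2"
proof -
  obtain c where c: "c \<in> A" "q \<in> fst c" using charts_cover q by blast
  interpret flow_chart M A g T c by unfold_locales (rule c)
  let ?x = "(snd c q, t)"
  have x: "?x \<in> dom c \<times> I" using c t by simp
  have "((\<lambda>s. scalar_curvature A (g s) q) has_real_derivative dder (0, 1) cal.Sc ?x) (at t)"
    by (rule time_slice[OF open_U open_I _ t cal.smooth_Sc]) (use c scalar_curvature_Sc in auto)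
  moreover have "dder (0, 1) cal.Sc ?x \<ge> 2 / real CARD('n) * (cal.Sc ?x)\<^sup>2"
  proof (rule cal.Sc_evolution_at_min[OF x])
    show "0 < (\<Sum>i\<in>UNIV. \<Sum>j\<in>UNIV. v i * v j * matrix_inv (mm (snd ?x) (fst ?x)) $ i $ j)"
      if "\<exists>i. v i \<noteq> 0" for v
      using pos_def_matrix_inv[OF mm_pos that] x by auto
    fix v :: "'n \<Rightarrow> real"
    let ?y = "?x + (\<Sum>i\<in>UNIV. v i *\<^sub>R (axis i 1, 0))"
    assume "?y \<in> dom c \<times> I"
    then have "fst ?y \<in> dom c" unfolding mem_Times_iff by (rule conjunct1)
    then obtain p where p: "fst ?y = snd c p" "p \<in> fst c" by blast
    \<comment> \<open>The directions \<open>e i\<close> have no time component, so the competing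
      point lies in the same time slice and minimality over the manifold applies to it.\<close>
    have "snd ?y = t" by (simp add: snd_sum)
    then have "?y = (snd c p, t)" using p(1) by (intro prod_eqI) simp_all
    then show "cal.Sc ?x \<le> cal.Sc ?y"
      using min[of p] chart(3)[OF c(1)] scalar_curvature_Sc[OF t] c(2) p(2) by auto
  qed
  ultimately show thesis using that scalar_curvature_Sc[OF t c(2)] by simp
qed

lemma isCont_scalar_curvature_time:
  assumes "q \<in> topspace M" "t \<in> {0<..<T}"
  shows "isCont (\<lambda>s. scalar_curvature A (g s) q) t"
proof -
  obtain c where c: "c \<in> A" "q \<in> fst c" using charts_cover assms(1) by blast
  interpret flow_chart M A g T c by unfold_locales (rule c)
  have "((\<lambda>s. scalar_curvature A (g s) q) has_real_derivative dder (0, 1) cal.Sc (snd c q, t)) (at t)"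
    by (rule time_slice[OF open_U open_I _ assms(2) cal.smooth_Sc]) (use c scalar_curvature_Sc in auto)
  then show ?thesis by (rule DERIV_isCont)
qed

text \<open>Joint continuity is needed so that the space-time points violating the comparison form a
  closed set. The products of chart domains with the time interval are an open cover, and the local
  pieces are restrictions of one global function, so their compatibility is automatic.\<close>

lemma continuous_scalar_curvature:
  "continuous_map (prod_topology M (top_of_set {0<..<T})) euclideanreal
    (\<lambda>z. scalar_curvature A (g (snd z)) (fst z))"
proof (rule pasting_lemma[where I = A and T = "\<lambda>c. fst c \<times> {0<..<T}"])
  fix c assume c: "c \<in> A"
  interpret flow_chart M A g T c by unfold_locales (rule c)
  show "openin (prod_topology M (top_of_set I)) (fst c \<times> I)"
    using chart(1)[OF c] openin_prod_Times_iff by fastforce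
  have sub: "subtopology (prod_topology M (top_of_set I)) (fst c \<times> I)
      = prod_topology (subtopology M (fst c)) (top_of_set I)"
    by (simp add: subtopology_Times subtopology_subtopology)
  have "continuous_map (prod_topology (subtopology M (fst c)) (top_of_set I))
      (prod_topology (top_of_set U) (top_of_set I)) (\<lambda>z. (snd c (fst z), snd z))"
    by (intro continuous_map_pairedI continuous_map_snd
        continuous_map_compose[OF continuous_map_fst chart(5)[OF c], unfolded o_def])
  moreover have "continuous_map (prod_topology (top_of_set U) (top_of_set I)) euclideanreal cal.Sc"
    using smooth_on_imp_continuous_on[OF cal.smooth_Sc]
    by (simp flip: subtopology_Times)
  ultimately have "continuous_map (prod_topology (subtopology M (fst c)) (top_of_set I)) euclideanreal
      (\<lambda>z. cal.Sc (snd c (fst z), snd z))"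
    using continuous_map_compose unfolding o_def by blast
  then show "continuous_map (subtopology (prod_topology M (top_of_set I)) (fst c \<times> I)) euclideanreal
      (\<lambda>z. scalar_curvature A (g (snd z)) (fst z))"
    unfolding sub by (rule continuous_map_eq) (auto simp: scalar_curvature_Sc)
next
  fix z assume "z \<in> topspace (prod_topology M (top_of_set {0<..<T}))"
  then show "\<exists>c. c \<in> A \<and> z \<in> fst c \<times> {0<..<T} \<and>
      scalar_curvature A (g (snd z)) (fst z) = scalar_curvature A (g (snd z)) (fst z)"
    using charts_cover by fastforce
qed simp

end

subsection \<open>The maximum principle\<close>

context manifold_ricci_flow
begin

lemma continuous_scalar_curvature_on:
  assumes "K \<subseteq> {0<..<T}"
  shows "continuous_map (prod_topology M (top_of_set K)) euclideanreal
    (\<lambda>z. scalar_curvature A (g (snd z)) (fst z))"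
proof -
  have "subtopology (prod_topology M (top_of_set {0<..<T})) (topspace M \<times> K) = prod_topology M (top_of_set K)"
    using assms by (simp add: subtopology_Times subtopology_subtopology Int_absorb1)
  then show ?thesis
    using continuous_map_from_subtopology[OF continuous_scalar_curvature, of "topspace M \<times> K"] by simp
qed

lemma bdd_below_scalar_curvature:
  assumes "compact_space M" "t \<in> {0<..<T}"
  shows "bdd_below (scalar_curvature A (g t) ` topspace M)"
proof -
  have "continuous_map M (prod_topology M (top_of_set {0<..<T})) (\<lambda>p. (p, t))"
    using assms(2) by (intro continuous_map_pairedI) auto
  then have "continuous_map M euclideanreal (\<lambda>p. scalar_curvature A (g t) p)"
    using continuous_map_compose[OF _ continuous_scalar_curvature] by (fastforce simp: o_def)
  then have "compactin euclideanreal (scalar_curvature A (g t) ` topspace M)"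
    using assms(1) image_compactin unfolding compact_space_def by fast
  then show ?thesis by (simp add: bounded_imp_bdd_below compact_imp_bounded)
qed

text \<open>Curvature that starts everywhere above n / (t1 - t0) would have to stay above n / (t1 -
  t), which blows up at t1, although the flow is still smooth there.\<close>

lemma scalar_curvature_not_above:
  assumes compact: "compact_space M" and nonempty: "topspace M \<noteq> {}"
    and t: "0 < t0" "t0 < t1" "t1 < T"
  shows "\<exists>q\<in>topspace M. scalar_curvature A (g t0) q \<le> real CARD('n) / (t1 - t0)"
proof (rule ccontr)
  assume not: "\<not> ?thesis"
  define n where "n = real CARD('n)"
  have n: "n > 0" by (simp add: n_def)
  define R where "R t q = scalar_curvature A (g t) q" for t q
  \<comment> \<open>Multiplying the comparison by t1 - t removes its singularity: \<open>w\<close>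
    is continuous up to and including t1.\<close>
  define w where "w t q = (t1 - t) * R t q - n" for t q
  define X where "X = prod_topology M (top_of_set {t0..t1})"
  define Z where "Z = {z \<in> topspace X. w (snd z) (fst z) \<in> {..0}}"
  have tsX: "topspace X = topspace M \<times> {t0..t1}" by (simp add: X_def)
  have cont: "continuous_map X euclideanreal (\<lambda>z. R (snd z) (fst z))"
    unfolding X_def R_def by (rule continuous_scalar_curvature_on) (use t in auto)
  have snd: "continuous_map X euclideanreal snd"
    unfolding X_def using continuous_map_snd continuous_map_into_fulltopology by blast
  have "continuous_map X euclideanreal (\<lambda>z. w (snd z) (fst z))"
    unfolding w_def by (intro continuous_intros cont snd) auto
  then have "closedin X Z"
    unfolding Z_def by (rule closedin_continuous_map_preimage) simp
  moreover have "compact_space X"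
    unfolding X_def using compact by (simp add: compact_space_prod_topology compact_space_subtopology)
  ultimately have "compactin X Z" by (rule closedin_compact_space[rotated])
  then have "compact (snd ` Z)"
    using image_compactin[OF _ snd] by simp
  moreover have "snd ` Z \<noteq> {}"
  \<comment> \<open>At t1 the factor of the curvature vanishes and \<open>w\<close> equals - n
    everywhere, so a first violation time exists.\<close>
  proof -
    obtain q where "q \<in> topspace M" using nonempty by blast
    then have "(q, t1) \<in> Z" using t n by (simp add: Z_def tsX w_def)
    then show ?thesis by blast
  qed
  ultimately obtain s where s: "s \<in> snd ` Z" "\<And>r. r \<in> snd ` Z \<Longrightarrow> s \<le> r"
    using compact_attains_inf by metis
  then obtain q where q: "(q, s) \<in> Z" by auto
  have st: "t0 \<le> s" "s \<le> t1" and qM: "q \<in> topspace M" and wq: "w s q \<le> 0"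
    using q by (auto simp: Z_def tsX)
  have "w t0 p > 0" if "p \<in> topspace M" for p
    using not that t by (auto simp: w_def R_def n_def field_simps not_le)
  then have "s \<noteq> t0" using qM wq by fastforce
  then have s0: "t0 < s" using st by simp
  have before: "w r p > 0" if "p \<in> topspace M" "t0 \<le> r" "r < s" for p r
  proof (rule ccontr)
    assume "\<not> w r p > 0"
    then have "(p, r) \<in> Z" using that st by (simp add: Z_def tsX)
    then show False using s(2)[of r] that by force
  qed
  have sI: "s \<in> {0<..<T}" using s0 st t by simp
  \<comment> \<open>Positivity before s gives nonnegativity at s by passing to the limit from the
    left, separately at each point p. Hence q, where \<open>w\<close> is not positive, is a zero and
    a spatial minimum of \<open>w\<close>.\<close>
  have at: "w s p \<ge> 0" if p: "p \<in> topspace M" for p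
  proof -
    have "isCont (\<lambda>r. w r p) s"
      unfolding w_def R_def by (intro continuous_intros isCont_scalar_curvature_time p sI)
    then have "((\<lambda>r. w r p) \<longlongrightarrow> w s p) (at_left s)"
      by (simp add: isCont_def filterlim_at_split)
    moreover have "\<forall>\<^sub>F r in at_left s. 0 \<le> w r p"
      using eventually_at_left_real[OF s0] by eventually_elim (use before[OF p] in \<open>auto intro: less_imp_le\<close>)
    ultimately show ?thesis
      by (intro tendsto_lowerbound) auto
  qed
  have w0: "w s q = 0" using at[OF qM] wq by simp
  then have "s \<noteq> t1" using n by (auto simp: w_def)
  then have s1: "s < t1" using st by simp
  have min: "R s q \<le> R s p" if "p \<in> topspace M" for p
  proof -
    have "(t1 - s) * R s q \<le> (t1 - s) * R s p" using at[OF that] w0 by (simp add: w_def)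
    then show ?thesis using s1 by simp
  qed
  obtain D where D: "((\<lambda>r. R r q) has_real_derivative D) (at s)" "D \<ge> 2 / n * (R s q)\<^sup>2"
    using scalar_curvature_evolution_at_min[OF qM sI] min unfolding R_def n_def by blast
  have Rn: "(t1 - s) * R s q = n" using w0 by (simp add: w_def)
  then have pos: "R s q > 0" using n s1 by (metis diff_gt_0_iff_gt zero_less_mult_pos)
  have "((\<lambda>r. w r q) has_real_derivative (t1 - s) * D - R s q) (at s)"
    unfolding w_def by (auto intro!: derivative_eq_intros D(1))
  moreover have "(t1 - s) * D - R s q > 0"
  proof -
    \<comment> \<open>At the contact point (t1 - s) R = n, so the quadratic lower bound contributes
      2 R. One R is consumed by the derivative of the factor t1 - r; the other is the strict
      gain.\<close>
    have "(t1 - s) * D \<ge> (t1 - s) * (2 / n * (R s q)\<^sup>2)"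
      using D(2) s1 by (intro mult_left_mono) auto
    also have "(t1 - s) * (2 / n * (R s q)\<^sup>2) = 2 / n * ((t1 - s) * R s q) * R s q"
      by (simp add: power2_eq_square)
    also have "\<dots> = 2 * R s q" unfolding Rn using n by simp
    finally show ?thesis using pos by simp
  qed
  ultimately obtain d where d: "d > 0" "\<And>r. 0 < r \<Longrightarrow> r < d \<Longrightarrow> w (s - r) q < w s q"
    using DERIV_pos_inc_left by blast
  \<comment> \<open>The time s - r is close enough to s for \<open>w\<close> to have dropped below
    zero at q, and still later than t0, where \<open>before\<close> asserts positivity.\<close>
  define r where "r = min d (s - t0) / 2"
  have "0 < r" "r < d" "r < s - t0" using d s0 by (auto simp: r_def)
  then show False using d(2)[of r] before[OF qM, of "s - r"] w0 by simp
qed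

end

theorem corollary1p6:
  fixes M :: "'m topology"
    and A :: "('m, 'n::finite) chart set"
    and g :: "real \<Rightarrow> ('m, 'n) metric"
    and T :: real
  assumes "T > 0"
    and "closed_manifold M A"
    and "ricci_flow M A T g"
  shows "\<forall>t\<in>{0<..<T}.
    (INF x\<in>topspace M. scalar_curvature A (g t) x)
      \<le> 2 * real CARD('n) / t + 2 * real CARD('n) / (T - t)"
proof
  fix t assume t: "t \<in> {0<..<T}"
  interpret manifold_ricci_flow M A g T
    using assms by unfold_locales (auto simp: closed_manifold_def)
  have M: "compact_space M" "topspace M \<noteq> {}"
    using assms(2) by (auto simp: closed_manifold_def)
  \<comment> \<open>At the midpoint of t and T the bound n / (?s - t) becomes the second term of the
    claim.\<close>
  let ?s = "(t + T) / 2"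
  obtain q where q: "q \<in> topspace M" "scalar_curvature A (g t) q \<le> real CARD('n) / (?s - t)"
    using scalar_curvature_not_above[OF M, of t ?s] t by auto
  \<comment> \<open>For reals, the infimum is a lower bound only if the values are bounded below;
    compactness of the manifold ensures this.\<close>
  have "(INF x\<in>topspace M. scalar_curvature A (g t) x) \<le> scalar_curvature A (g t) q"
    by (rule cINF_lower[OF bdd_below_scalar_curvature[OF M(1) t] q(1)])
  also have "\<dots> \<le> real CARD('n) / (?s - t)" by (rule q(2))
  also have "\<dots> = 2 * real CARD('n) / (T - t)"
    using t by (simp add: field_simps)
  also have "\<dots> \<le> 2 * real CARD('n) / t + 2 * real CARD('n) / (T - t)"
    using t by simp
  finally show "(INF x\<in>topspace M. scalar_curvature A (g t) x)
      \<le> 2 * real CARD('n) / t + 2 * real CARD('n) / (T - t)" .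
qed

end
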